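(* Let $d\ge2$, $T\ge1$, $t\in\{1,\dots,T\}$, $x_1,\dots,x_{T}\in\mathbb{R}^d_+\setminus\{0\}$, $\lambda\ge1$ and $\mu>0$. Then any optimal solution $\bar\phi_t$ of the problem $$\min\Big\{\bar F_{t-1}[\phi]\ :\ \hat w\in\mathrm{ri}(\Delta_d),\ \mathbb{E}_{w\sim\phi}[w]=\hat w,\ \phi\in\mathsf{Supp}(\mathcal{E}_{t-1,1/4}(\hat w))\Big\}$$ satisfies $$F_{t-1}[\bar\phi_t]\ \le\ \bar F_{t-1}[\bar\phi_t]\ \le\ \min_{\phi\in\mathsf{Supp}(\Delta_d)}F_{t-1}[\phi]\;+\;1.5\,\mu(d-1)\log(T+\lambda d)+3.9\,\mu(d+1)+0.1.$$
   Context: $\Delta_d=\{w\in\mathbb{R}^d_+:\sum_i w[i]=1\}$ is the standard simplex, $\mathrm{ri}(\Delta_d)$ its relative interior, and $\mathbb{A}_d=\{w\in\mathbb{R}^d:\sum_iw[i]=1\}$. For $w\in\mathbb{R}^d_{++}$ (positive orthant) let $L_{t-1}(w)=\sum_{\tau=1}^{t-1}-\log(x_\tau^\top w)-\lambda\sum_{i=1}^d\log(w[i])$, and $L_{t-1}(w)=+\infty$ otherwise. For $\hat w\in\mathrm{ri}(\Delta_d)$ and $r>0$, the Dikin ellipsoid is $$\mathcal{E}_{t-1,r}(\hat w)=\{w\in\mathbb{A}_d:\ (w-\hat w)^\top\nabla^2L_{t-1}(\hat w)(w-\hat w)<r^2\}.$$ For a set $S\subset\mathbb{A}_d$, $\mathsf{Supp}(S)$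 is the set of probability densities (with respect to the $(d-1)$-dimensional Lebesgue measure on $\mathbb{A}_d$) supported on $S$. $\mathrm{Ent}[\phi]=\mathbb{E}_{w\sim\phi}[-\log\phi(w)]$ is the differential entropy and $\mathrm{Cov}[\phi]$ the $d\times d$ covariance matrix. Define $$F_{t-1}[\phi]=\mathbb{E}_{w\sim\phi}[L_{t-1}(w)]-\mu\,\mathrm{Ent}[\phi],$$ and, for $\phi$ with mean $\hat w=\mathbb{E}_{w\sim\phi}[w]\in\mathrm{ri}(\Delta_d)$, $$\bar F_{t-1}[\phi]=L_{t-1}(\hat w)+\tfrac45\mathrm{tr}\big(\nabla^2L_{t-1}(\hat w)\,\mathrm{Cov}[\phi]\big)-\mu\,\mathrm{Ent}[\phi].$$ *)

theory Defs
  imports "HOL-Analysis.Analysis"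
begin

definition std_simplex :: "(real ^ 'n) set" where
  "std_simplex = {w. (\<forall>i. 0 \<le> w $ i) \<and> (\<Sum>i\<in>UNIV. w $ i) = 1}"

definition simplex_hull :: "(real ^ 'n) set" where
  "simplex_hull = {w. (\<Sum>i\<in>UNIV. w $ i) = 1}"


text \<open>The $(d-1)$-dimensional Lebesgue measure on the hyperplane \<^const>\<open>simplex_hull\<close>: the image
  of the product Lebesgue measure under an isometric parametrisation, just as \<^const>\<open>lborel\<close> is
  obtained from the standard basis. By rotation invariance it does not depend on the chosen
  orthonormal basis. It is a Borel measure on the ambient space, null outside the hyperplane.\<close>

definition orthonormal_basis_of :: "(real ^ 'n) set \<Rightarrow> (real ^ 'n) set \<Rightarrow> bool" where
  "orthonormal_basis_of V B \<longleftrightarrow>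
     finite B \<and> pairwise orthogonal B \<and> (\<forall>b\<in>B. norm b = 1) \<and> span B = V"

definition hull_directions :: "(real ^ 'n) set" where
  "hull_directions = {v. (\<Sum>i\<in>UNIV. v $ i) = 0}"

lemma ex_orthonormal_basis_hull_directions:
  "\<exists>B. orthonormal_basis_of (hull_directions :: (real ^ 'n) set) B"
proof -
  have "subspace (hull_directions :: (real ^ 'n) set)"
    by (auto simp: hull_directions_def subspace_def sum.distrib simp flip: sum_distrib_left)
  then obtain B :: "(real ^ 'n) set" where "pairwise orthogonal B" "\<And>b. b \<in> B \<Longrightarrow> norm b = 1"
    "independent B" "span B = hull_directions"
    by (metis orthonormal_basis_subspace)
  then show ?thesis
    unfolding orthonormal_basis_of_def using independent_imp_finite by blast
qed

definition hull_basis :: "(real ^ 'n) set" where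
  "hull_basis = (SOME B. orthonormal_basis_of hull_directions B)"

definition hull_lborel :: "(real ^ 'n) measure" where
  "hull_lborel = distr (\<Pi>\<^sub>M b\<in>hull_basis. (lborel :: real measure)) borel
     (\<lambda>f. (\<chi> i. 1 / real CARD('n)) + (\<Sum>b\<in>hull_basis. f b *\<^sub>R b))"


text \<open>Densities are determined only up to null sets, so restricting to Borel representatives loses
  nothing, and ``supported on \<open>S\<close>'' means vanishing almost everywhere outside \<open>S\<close>.\<close>

definition Supp :: "(real ^ 'n) set \<Rightarrow> (real ^ 'n \<Rightarrow> real) set" where
  "Supp S = {\<phi>. \<phi> \<in> borel_measurable borel \<and> (\<forall>w. 0 \<le> \<phi> w)
     \<and> (\<integral>\<^sup>+w. ennreal (\<phi> w) \<partial>hull_lborel) = 1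
     \<and> (AE w in hull_lborel. w \<notin> S \<longrightarrow> \<phi> w = 0)}"

definition law :: "(real ^ 'n \<Rightarrow> real) \<Rightarrow> (real ^ 'n) measure" where
  "law \<phi> = density hull_lborel (\<lambda>w. ennreal (\<phi> w))"

text \<open>Expectation of an extended-real function, possibly infinite (\<^const>\<open>e2ennreal\<close> truncates
  negative values to 0). The Bochner integral would give non-integrable functions the value 0, which
  is not usable here: the expected loss may be \<open>\<infinity>\<close>, the entropy may be \<open>-\<infinity>\<close>.
  For densities supported on the simplex the positive and negative parts are never both infinite,
  neither in the expected loss nor in the entropy.\<close>

definition ext_expectation :: "'a measure \<Rightarrow> ('a \<Rightarrow> ereal) \<Rightarrow> ereal" where
  "ext_expectation M f =
     enn2ereal (\<integral>\<^sup>+w. e2ennreal (f w) \<partial>M) - enn2ereal (\<integral>\<^sup>+w. e2ennreal (- f w) \<partial>M)"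

definition Ent :: "(real ^ 'n \<Rightarrow> real) \<Rightarrow> ereal" where
  "Ent \<phi> = ext_expectation (law \<phi>) (\<lambda>w. ereal (- ln (\<phi> w)))"

definition mean :: "(real ^ 'n \<Rightarrow> real) \<Rightarrow> real ^ 'n" where
  "mean \<phi> = (\<integral>w. w \<partial>law \<phi>)"

definition Cov :: "(real ^ 'n \<Rightarrow> real) \<Rightarrow> real ^ 'n ^ 'n" where
  "Cov \<phi> = (\<chi> i j. \<integral>w. (w $ i - mean \<phi> $ i) * (w $ j - mean \<phi> $ j) \<partial>law \<phi>)"

definition hessian :: "(real ^ 'n \<Rightarrow> real) \<Rightarrow> real ^ 'n \<Rightarrow> real ^ 'n ^ 'n" where
  "hessian f w = (\<chi> i j.
     frechet_derivative (\<lambda>u. frechet_derivative f (at u) (axis j 1)) (at w) (axis i 1))"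


text \<open>\<open>loss lam x s\<close> is $L_s$. Its finite part \<open>loss_fin\<close> is only meaningful on the positive
  orthant, and its Hessian is only taken there.\<close>

definition loss_fin :: "real \<Rightarrow> (nat \<Rightarrow> real ^ 'n) \<Rightarrow> nat \<Rightarrow> real ^ 'n \<Rightarrow> real" where
  "loss_fin lam x s w = (\<Sum>\<tau>\<in>{1..s}. - ln (x \<tau> \<bullet> w)) - lam * (\<Sum>i\<in>UNIV. ln (w $ i))"

definition loss :: "real \<Rightarrow> (nat \<Rightarrow> real ^ 'n) \<Rightarrow> nat \<Rightarrow> real ^ 'n \<Rightarrow> ereal" where
  "loss lam x s w = (if \<forall>i. 0 < w $ i then ereal (loss_fin lam x s w) else \<infinity>)"

definition dikin :: "real \<Rightarrow> (nat \<Rightarrow> real ^ 'n) \<Rightarrow> nat \<Rightarrow> real \<Rightarrow> real ^ 'n \<Rightarrow> (real ^ 'n) set" where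
  "dikin lam x s r c =
     {w \<in> simplex_hull. (w - c) \<bullet> (hessian (loss_fin lam x s) c *v (w - c)) < r\<^sup>2}"

definition F :: "real \<Rightarrow> real \<Rightarrow> (nat \<Rightarrow> real ^ 'n) \<Rightarrow> nat \<Rightarrow> (real ^ 'n \<Rightarrow> real) \<Rightarrow> ereal" where
  "F \<mu> lam x s \<phi> = ext_expectation (law \<phi>) (loss lam x s) - ereal \<mu> * Ent \<phi>"

definition Fbar :: "real \<Rightarrow> real \<Rightarrow> (nat \<Rightarrow> real ^ 'n) \<Rightarrow> nat \<Rightarrow> (real ^ 'n \<Rightarrow> real) \<Rightarrow> ereal" where
  "Fbar \<mu> lam x s \<phi> = loss lam x s (mean \<phi>)
     + ereal (4 / 5 * trace (hessian (loss_fin lam x s) (mean \<phi>) ** Cov \<phi>))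
     - ereal \<mu> * Ent \<phi>"

definition feasible :: "real \<Rightarrow> (nat \<Rightarrow> real ^ 'n) \<Rightarrow> nat \<Rightarrow> (real ^ 'n \<Rightarrow> real) set" where
  "feasible lam x s =
     {\<phi>. \<exists>c \<in> rel_interior std_simplex. mean \<phi> = c \<and> \<phi> \<in> Supp (dikin lam x s (1 / 4) c)}"

end

theory Submission
  imports Defs
begin

text \<open>Write $L$ for the loss after $s = t - 1$ rounds, $d$ for the dimension and $N = s + \<lambda> d$.

\<^emph>\<open>The surrogate dominates the objective.\<close> Seen from a positive point $c$, the loss at a positive $w$ is $L(c)$
plus one term $-\log(1+u)$ for each linear form inside a logarithm, with the weight $1$ or $\lambda$ of that
logarithm, where $u$ is the relative change of the form between $c$ and $w$. With the same weights,
all of them at least 1, the squares of these $u$ add up to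
$(w-c)^\top \nabla^2 L(c) (w-c)$. Inside the Dikin ellipsoid of radius $1/4$ every $|u|$ is therefore
below $1/4$, where $-\log(1+u) \le -u + \frac45 u^2$. Summing gives
$L(w) \le L(c) + \nabla L(c)^\top (w-c) + \frac45 (w-c)^\top \nabla^2 L(c) (w-c)$
(\<open>loss_fin_le_quadratic\<close>). Averaged over a density with mean $c$, the linear term vanishes and the
quadratic one becomes the trace in the surrogate (\<open>F_le_Fbar\<close>).

\<^emph>\<open>The surrogate is nearly optimal.\<close> By Gibbs' inequality the smallest value of the objective is
$-\mu \log Z$ with $Z = \int e^{-L/\mu}$, attained by the density $e^{-L/\mu}/Z$
(\<open>gibbs_variational\<close>, \<open>F_gibbs_density\<close>). If $c$ minimises $L$ over the simplex, then
$Z \le e^{-L(c)/\mu} \mathrm{vol}(\Delta_d)$, so this value is at least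
$L(c) - \mu \log \mathrm{vol}(\Delta_d)$. In the other direction, an optimal feasible density is
at least as good as the uniform density on a small box centred at $c$ and contained in the Dikin
ellipsoid; its surrogate value is at most $L(c) + \frac{1}{20} - \mu \log \mathrm{vol}(\mathrm{box})$.
The loss at $c$ cancels and only a ratio of volumes is left.

Two facts control the ratio. The simplex lies in a box of half-side 2 around $c$, so the ratio is at
most that of two boxes, $(2/r)^{d-1}$, where $r$ is the half-side of the small box.
And $r$ need not be tiny: stationarity of $L$ at $c$ reads
$\sum_\tau x_\tau[i]/(x_\tau^\top c) + \lambda/c[i] = N$ for every $i$, which makes every
$c[i]$ at least $1/N$ and, through the Cauchy--Schwarz inequality, bounds the Hessian at $c$ by $N^2$
(\<open>loss_curv_minimiser_le\<close>). Hence $r = 1/(4 N \sqrt d)$ is small enough, and the gap is at most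
$\mu (d-1) \log(8 N \sqrt d) + \frac1{20}$. The exponent $1.5$ in the bound pays for $N$ and
$\sqrt d$, and $3.9 > \log 8$ for the constant.\<close>

section \<open>The hyperplane measure in orthonormal coordinates\<close>

lemma orthonormal_basis_hull_basis:
  "orthonormal_basis_of (hull_directions :: (real ^ 'n) set) hull_basis"
  unfolding hull_basis_def by (rule someI_ex) (rule ex_orthonormal_basis_hull_directions)

lemma finite_hull_basis [simp]: "finite (hull_basis :: (real ^ 'n) set)"
  and pairwise_orthogonal_hull_basis: "pairwise orthogonal (hull_basis :: (real ^ 'n) set)"
  and norm_hull_basis: "b \<in> (hull_basis :: (real ^ 'n) set) \<Longrightarrow> norm b = 1"
  and span_hull_basis: "span (hull_basis :: (real ^ 'n) set) = hull_directions"
  using orthonormal_basis_hull_basis[where 'n='n] by (auto simp: orthonormal_basis_of_def)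

lemma inner_hull_basis:
  assumes "b \<in> (hull_basis :: (real ^ 'n) set)" "b' \<in> hull_basis"
  shows "b \<bullet> b' = (if b = b' then 1 else 0)"
  using assms pairwise_orthogonal_hull_basis[where 'n='n] norm_hull_basis[of b]
  by (auto simp: pairwise_def orthogonal_def norm_eq_1)

lemma card_hull_basis: "card (hull_basis :: (real ^ 'n) set) = CARD('n) - 1"
proof -
  have "(0::real^'n) \<notin> hull_basis"
    using norm_hull_basis[of "0::real^'n"] by auto
  then have "independent (hull_basis :: (real ^ 'n) set)"
    using pairwise_orthogonal_hull_basis pairwise_orthogonal_independent by blast
  then have "card (hull_basis :: (real ^ 'n) set) = dim (hull_directions :: (real ^ 'n) set)"
    by (metis dim_eq_card_independent dim_span span_hull_basis)
  also have "(hull_directions :: (real ^ 'n) set) = {v. (1::real^'n) \<bullet> v = 0}"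
    by (simp add: hull_directions_def inner_vec_def)
  also have "dim \<dots> = CARD('n) - 1"
    by (subst dim_hyperplane) (auto simp: vec_eq_iff)
  finally show ?thesis .
qed

definition hull_param :: "(real ^ 'n \<Rightarrow> real) \<Rightarrow> real ^ 'n" where
  "hull_param f = (\<chi> i. 1 / real CARD('n)) + (\<Sum>b\<in>hull_basis. f b *\<^sub>R b)"

abbreviation coord_lborel :: "(real ^ 'n \<Rightarrow> real) measure" where
  "coord_lborel \<equiv> \<Pi>\<^sub>M b\<in>(hull_basis :: (real ^ 'n) set). (lborel :: real measure)"

lemma hull_lborel_eq_distr: "hull_lborel = distr coord_lborel borel hull_param"
  unfolding hull_lborel_def hull_param_def[abs_def] ..

lemma hull_param_measurable [measurable]: "hull_param \<in> borel_measurable coord_lborel"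
  unfolding hull_param_def[abs_def] by measurable

lemma sets_hull_lborel [simp, measurable_cong]: "sets hull_lborel = sets borel"
  and space_hull_lborel [simp]: "space hull_lborel = UNIV"
  by (simp_all add: hull_lborel_eq_distr)

lemma sum_hull_basis:
  assumes "b \<in> (hull_basis :: (real ^ 'n) set)" shows "(\<Sum>i\<in>UNIV. b $ i) = 0"
  using span_base[OF assms] by (simp add: span_hull_basis hull_directions_def)

lemma hull_param_in_hull: "hull_param f \<in> simplex_hull"
proof -
  have "(\<Sum>i\<in>UNIV. (\<Sum>b\<in>hull_basis. f b *\<^sub>R b) $ i) = (\<Sum>b\<in>(hull_basis::(real^'a) set). f b * (\<Sum>i\<in>UNIV. b $ i))"
    by (simp add: sum_distrib_left) (rule sum.swap)
  then show ?thesis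
    by (simp add: hull_param_def simplex_hull_def sum.distrib sum_hull_basis)
qed

lemma hull_param_inner:
  assumes "b \<in> (hull_basis :: (real ^ 'n) set)" shows "hull_param f \<bullet> b = f b"
proof -
  have "(\<chi> i. 1 / real CARD('n)) \<bullet> b = 0"
    using sum_hull_basis[OF assms] by (simp add: inner_vec_def flip: sum_divide_distrib)
  moreover have "(\<Sum>b'\<in>hull_basis. f b' *\<^sub>R b') \<bullet> b = (\<Sum>b'\<in>hull_basis. if b' = b then f b' else 0)"
    unfolding inner_sum_left using assms by (intro sum.cong) (auto simp: inner_hull_basis)
  ultimately show ?thesis
    using assms by (simp add: hull_param_def inner_add_left)
qed

lemma AE_hull_lborel_in_hull: "AE w in hull_lborel. w \<in> simplex_hull"
proof -
  have "closed (simplex_hull :: (real^'a) set)"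
    unfolding simplex_hull_def by (intro closed_Collect_eq continuous_intros)
  then show ?thesis
    unfolding hull_lborel_eq_distr by (subst AE_distr_iff) (auto simp: hull_param_in_hull)
qed

lemma hull_directions_expansion:
  assumes "v \<in> (hull_directions :: (real ^ 'n) set)"
  shows "v = (\<Sum>b\<in>hull_basis. (v \<bullet> b) *\<^sub>R b)"
    and "v \<bullet> v = (\<Sum>b\<in>hull_basis. (v \<bullet> b)\<^sup>2)"
proof -
  show *: "v = (\<Sum>b\<in>hull_basis. (v \<bullet> b) *\<^sub>R b)"
  proof -
    obtain g where v: "v = (\<Sum>b\<in>hull_basis. g b *\<^sub>R b)"
      using assms span_finite[OF finite_hull_basis] by (auto simp flip: span_hull_basis)
    have "v \<bullet> b = g b" if "b \<in> hull_basis" for b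
    proof -
      have "v \<bullet> b = (\<Sum>b'\<in>hull_basis. if b' = b then g b' else 0)"
        unfolding v inner_sum_left using that by (intro sum.cong) (auto simp: inner_hull_basis)
      then show ?thesis using that by simp
    qed
    then show ?thesis using v by simp
  qed
  have "v \<bullet> v = v \<bullet> (\<Sum>b\<in>hull_basis. (v \<bullet> b) *\<^sub>R b)" using * by simp
  also have "\<dots> = (\<Sum>b\<in>hull_basis. (v \<bullet> b)\<^sup>2)"
    by (simp add: inner_sum_right power2_eq_square)
  finally show "v \<bullet> v = (\<Sum>b\<in>hull_basis. (v \<bullet> b)\<^sup>2)" .
qed

lemma diff_in_hull_directions:
  "w \<in> simplex_hull \<Longrightarrow> c \<in> simplex_hull \<Longrightarrow> w - c \<in> hull_directions"
  by (simp add: simplex_hull_def hull_directions_def sum_subtractf)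

text \<open>Volumes on the hyperplane are only ever compared through boxes aligned with the orthonormal basis,
because in coordinates such a box is a product of intervals, so that its volume and its barycentre
follow from Fubini's theorem.\<close>

definition hull_box :: "real ^ 'n \<Rightarrow> real \<Rightarrow> (real ^ 'n) set" where
  "hull_box c r = {w. \<forall>b\<in>hull_basis. \<bar>(w - c) \<bullet> b\<bar> < r}"

lemma hull_box_borel [measurable]: "hull_box c r \<in> sets borel"
proof -
  have "hull_box c r = (\<Inter>b\<in>hull_basis. {w. \<bar>(w - c) \<bullet> b\<bar> < r})"
    by (auto simp: hull_box_def)
  also have "open \<dots>"
    by (intro open_INT finite_hull_basis ballI open_Collect_less continuous_intros)
  finally show ?thesis by simp
qed

interpretation coord: product_sigma_finite "\<lambda>_::real^'n. lborel :: real measure"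
  by standard

lemma indicator_hull_box:
  "indicator (hull_box c r) (hull_param f) =
     (\<Prod>b\<in>(hull_basis::(real^'n) set). indicator {c \<bullet> b - r <..< c \<bullet> b + r} (f b) :: real)"
proof (cases "hull_param f \<in> hull_box c r")
  case True
  then have "\<forall>b\<in>hull_basis. indicator {c \<bullet> b - r <..< c \<bullet> b + r} (f b) = (1::real)"
    by (auto simp: hull_box_def inner_diff_left hull_param_inner abs_less_iff)
  then show ?thesis using True by simp
next
  case False
  then obtain b where b: "b \<in> hull_basis" "f b \<notin> {c \<bullet> b - r <..< c \<bullet> b + r}"
    by (auto simp: hull_box_def inner_diff_left hull_param_inner abs_less_iff)
  then show ?thesis using False by (intro trans[OF _ prod_zero[symmetric]]) (auto intro!: bexI[of _ b])
qed

lemma emeasure_hull_box: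
  fixes c :: "real ^ 'n"
  assumes "r > 0"
  shows "emeasure hull_lborel (hull_box c r) = ennreal ((2 * r) ^ (CARD('n) - 1))"
proof -
  have "emeasure hull_lborel (hull_box c r) = emeasure coord_lborel (hull_param -` hull_box c r \<inter> space coord_lborel)"
    unfolding hull_lborel_eq_distr by (subst emeasure_distr) auto
  also have "hull_param -` hull_box c r \<inter> space coord_lborel = (\<Pi>\<^sub>E b\<in>hull_basis. {c \<bullet> b - r <..< c \<bullet> b + r})"
    by (auto simp: hull_box_def inner_diff_left hull_param_inner space_PiM PiE_iff abs_less_iff; force)
  also have "emeasure coord_lborel \<dots> = (\<Prod>b\<in>(hull_basis::(real^'n) set). emeasure lborel {c \<bullet> b - r <..< c \<bullet> b + r})"
    by (rule coord.emeasure_PiM) auto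
  also have "\<dots> = (\<Prod>b\<in>(hull_basis::(real^'n) set). ennreal (2 * r))"
    using assms by simp
  also have "\<dots> = ennreal ((2 * r) ^ (CARD('n) - 1))"
    using assms by (simp add: ennreal_power card_hull_basis)
  finally show ?thesis .
qed

text \<open>The barycentre of a box is its centre. Expanding $w - c$ in the basis turns the integral into a sum of
integrals of products of one-variable functions, each with one factor that is odd about the
midpoint of its interval.\<close>

lemma integral_hull_box_centred:
  fixes c :: "real ^ 'n"
  assumes "r > 0" "c \<in> simplex_hull"
  shows "(\<integral>w. indicator (hull_box c r) w *\<^sub>R (w - c) \<partial>hull_lborel) = 0"
proof -
  let ?I = "\<lambda>b. indicator {c \<bullet> b - r <..< c \<bullet> b + r} :: real \<Rightarrow> real"
  \<comment> \<open>the factor for coordinate \<open>b\<close> in the integral of the component of $w - c$ along \<open>b0\<close>\<close>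
  let ?g = "\<lambda>b0 b y. ?I b y * (if b = b0 then y - c \<bullet> b else 1)"
  have I: "integrable lborel (\<lambda>y. ?g b0 b y)" for b0 b
  proof -
    have "integrable lborel (\<lambda>y. indicator {c \<bullet> b - r .. c \<bullet> b + r} y *\<^sub>R (if b = b0 then y - c \<bullet> b else 1))"
      by (cases "b = b0"; intro borel_integrable_compact) (auto intro!: continuous_intros)
    then show ?thesis
      by (rule Bochner_Integration.integrable_bound) (auto simp: indicator_def)
  qed
  have exp: "indicator (hull_box c r) (hull_param f) *\<^sub>R (hull_param f - c)
      = (\<Sum>b0\<in>hull_basis. (\<Prod>b\<in>hull_basis. ?g b0 b (f b)) *\<^sub>R b0)" for f
  proof -
    have "hull_param f - c = (\<Sum>b0\<in>hull_basis. (f b0 - c \<bullet> b0) *\<^sub>R b0)"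
      by (subst hull_directions_expansion[OF diff_in_hull_directions[OF hull_param_in_hull assms(2)]])
         (auto intro!: sum.cong simp: inner_diff_left hull_param_inner)
    moreover have "(\<Prod>b\<in>hull_basis. ?g b0 b (f b)) = (\<Prod>b\<in>hull_basis. ?I b (f b)) * (f b0 - c \<bullet> b0)"
      if "b0 \<in> hull_basis" for b0
      using that by (simp add: prod.distrib cong: if_cong)
    ultimately show ?thesis
      by (simp add: indicator_hull_box scaleR_sum_right)
  qed
  have mean0: "(\<integral>y. ?g b0 b0 y \<partial>lborel) = 0" for b0
  proof -
    \<comment> \<open>reflect in the midpoint of the interval\<close>
    have "(\<integral>y. ?g b0 b0 y \<partial>lborel) = (\<integral>y. ?g b0 b0 (2 * (c \<bullet> b0) + (-1) * y) \<partial>lborel)"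
      by (subst lborel_integral_real_affine[where c="-1" and t="2 * (c \<bullet> b0)"]) auto
    also have "(\<lambda>y. ?g b0 b0 (2 * (c \<bullet> b0) + (-1) * y)) = (\<lambda>y. - ?g b0 b0 y)"
      by (auto simp: fun_eq_iff indicator_def)
    finally show ?thesis by simp
  qed
  have "(\<integral>w. indicator (hull_box c r) w *\<^sub>R (w - c) \<partial>hull_lborel)
      = (\<integral>f. indicator (hull_box c r) (hull_param f) *\<^sub>R (hull_param f - c) \<partial>coord_lborel)"
    unfolding hull_lborel_eq_distr by (subst integral_distr) auto
  also have "\<dots> = (\<Sum>b0\<in>hull_basis. (\<integral>f. (\<Prod>b\<in>hull_basis. ?g b0 b (f b)) \<partial>coord_lborel) *\<^sub>R b0)"
    unfolding exp
    by (subst Bochner_Integration.integral_sum)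
      (auto intro!: integrable_scaleR_left coord.product_integrable_prod I sum.cong
        integral_scaleR_left)
  also have "\<dots> = (\<Sum>b0\<in>hull_basis. (\<Prod>b\<in>hull_basis. \<integral>y. ?g b0 b y \<partial>lborel) *\<^sub>R b0)"
    by (subst coord.product_integral_prod) (auto intro!: I)
  also have "\<dots> = 0"
  proof (intro sum.neutral ballI)
    fix b0 :: "real^'n" assume b0: "b0 \<in> hull_basis"
    have "(\<Prod>b\<in>hull_basis. \<integral>y. ?g b0 b y \<partial>lborel) = 0"
      using b0 mean0[of b0] by (intro prod_zero) (auto intro!: bexI[of _ b0])
    then show "(\<Prod>b\<in>hull_basis. \<integral>y. ?g b0 b y \<partial>lborel) *\<^sub>R b0 = 0" by simp
  qed
  finally show ?thesis .
qed

section \<open>The standard simplex\<close>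

lemma convex_std_simplex: "convex (std_simplex :: (real ^ 'n) set)"
  unfolding convex_def std_simplex_def
  by (auto simp: sum.distrib simp flip: sum_distrib_left)

lemma axis_in_simplex: "axis i 1 \<in> (std_simplex :: (real ^ 'n) set)"
  by (auto simp: std_simplex_def axis_def)

lemma std_simplex_le_1:
  assumes "w \<in> (std_simplex :: (real ^ 'n) set)" shows "w $ i \<le> 1"
  using assms member_le_sum[of i UNIV "\<lambda>i. w $ i"] by (auto simp: std_simplex_def)

lemma std_simplex_iff: "w \<in> std_simplex \<longleftrightarrow> (\<forall>i. 0 \<le> w $ i) \<and> w \<in> simplex_hull"
  by (auto simp: std_simplex_def simplex_hull_def)

text \<open>A point of a convex set is relatively interior iff every segment from the set to the point can be
prolonged a little beyond it. Segments from the vertices force all coordinates to be positive;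
conversely, prolonging by the smallest coordinate keeps them nonnegative.\<close>

lemma rel_interior_std_simplex_iff:
  "w \<in> rel_interior (std_simplex :: (real ^ 'n) set) \<longleftrightarrow> (\<forall>i. 0 < w $ i) \<and> w \<in> simplex_hull"
proof (intro iffI conjI allI)
  assume w: "w \<in> rel_interior (std_simplex :: (real ^ 'n) set)"
  then have "w \<in> std_simplex" using rel_interior_subset by blast
  then show "w \<in> simplex_hull" by (simp add: std_simplex_iff)
  fix i
  obtain e where e: "e > 1" "(1 - e) *\<^sub>R axis i 1 + e *\<^sub>R w \<in> std_simplex"
    using w convex_rel_interior_iff[OF convex_std_simplex] axis_in_simplex by fastforce
  then have "0 \<le> (1 - e) + e * w $ i"
    by (auto simp: std_simplex_def axis_def dest: spec[of _ i])
  then have "0 < e * w $ i" using e by linarith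
  then show "0 < w $ i" using e by (simp add: zero_less_mult_iff)
next
  assume w: "(\<forall>i. 0 < w $ i) \<and> w \<in> simplex_hull"
  have "\<exists>e>1. (1 - e) *\<^sub>R v + e *\<^sub>R w \<in> std_simplex" if v: "v \<in> std_simplex" for v
  proof -
    define \<delta> where "\<delta> = Min (range (\<lambda>i. w $ i))"
    have "0 < \<delta>" using w by (simp add: \<delta>_def)
    moreover have "(1 - (1 + \<delta>)) *\<^sub>R v + (1 + \<delta>) *\<^sub>R w \<in> std_simplex"
      unfolding std_simplex_def
    proof (intro CollectI conjI allI)
      fix i
      have "\<delta> \<le> w $ i" by (simp add: \<delta>_def)
      moreover have "\<delta> * v $ i \<le> \<delta>"
        using std_simplex_le_1[OF v, of i] \<open>0 < \<delta>\<close> by (simp add: mult_left_le)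
      moreover have "0 \<le> \<delta> * w $ i" using w \<open>0 < \<delta>\<close> by (simp add: less_imp_le)
      ultimately show "0 \<le> ((1 - (1 + \<delta>)) *\<^sub>R v + (1 + \<delta>) *\<^sub>R w) $ i"
        by (simp add: algebra_simps)
      show "(\<Sum>i\<in>UNIV. ((1 - (1 + \<delta>)) *\<^sub>R v + (1 + \<delta>) *\<^sub>R w) $ i) = 1"
        using v w by (simp add: std_simplex_def simplex_hull_def sum.distrib sum_subtractf sum_negf
            flip: sum_distrib_left)
    qed
    ultimately show ?thesis by (intro exI[of _ "1 + \<delta>"]) auto
  qed
  then show "w \<in> rel_interior std_simplex"
    using convex_rel_interior_iff[OF convex_std_simplex] axis_in_simplex by blast
qed

lemma compact_std_simplex: "compact (std_simplex :: (real ^ 'n) set)"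
proof (rule compact_eq_bounded_closed[THEN iffD2, OF conjI])
  have "norm w \<le> real CARD('n)" if "w \<in> std_simplex" for w :: "real ^ 'n"
  proof -
    have "norm w \<le> (\<Sum>i\<in>UNIV. \<bar>w $ i\<bar>)" by (rule norm_le_l1_cart)
    also have "\<dots> \<le> (\<Sum>i\<in>(UNIV::'n set). 1)"
      using that std_simplex_le_1[OF that] by (intro sum_mono) (auto simp: std_simplex_def)
    finally show ?thesis by simp
  qed
  then show "bounded (std_simplex :: (real ^ 'n) set)" by (auto simp: bounded_iff)
  show "closed (std_simplex :: (real ^ 'n) set)"
    unfolding std_simplex_def
    by (intro closed_Collect_conj closed_Collect_all closed_Collect_le closed_Collect_eq continuous_intros)
qed

text \<open>Two points of the simplex are at distance at most $\sqrt 2$, since squared differences of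
coordinates in $[0,1]$ are at most the sum of the coordinates. This crude enclosure is all
that is ever used about the volume of the simplex.\<close>

lemma std_simplex_subset_hull_box:
  fixes c :: "real ^ 'n"
  assumes "c \<in> std_simplex" shows "std_simplex \<subseteq> hull_box c 2"
proof
  fix w :: "real ^ 'n" assume w: "w \<in> std_simplex"
  have "(norm (w - c))\<^sup>2 = (\<Sum>i\<in>UNIV. (w $ i - c $ i)\<^sup>2)"
    unfolding power2_norm_eq_inner inner_vec_def by (simp add: power2_eq_square)
  also have "\<dots> \<le> (\<Sum>i\<in>UNIV. w $ i + c $ i)"
  proof (rule sum_mono)
    fix i
    have *: "0 \<le> w $ i" "0 \<le> c $ i" "w $ i \<le> 1" "c $ i \<le> 1"
      using w assms std_simplex_le_1 by (auto simp: std_simplex_def)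
    then have "\<bar>w $ i - c $ i\<bar> \<le> 1" by linarith
    then have "(w $ i - c $ i)\<^sup>2 \<le> \<bar>w $ i - c $ i\<bar>"
      using mult_left_le[of "\<bar>w $ i - c $ i\<bar>" "\<bar>w $ i - c $ i\<bar>"] by (simp add: power2_eq_square)
    also have "\<dots> \<le> w $ i + c $ i" using * by linarith
    finally show "(w $ i - c $ i)\<^sup>2 \<le> w $ i + c $ i" .
  qed
  also have "\<dots> = 2" using w assms by (simp add: std_simplex_def sum.distrib)
  also have "(2::real) < 2\<^sup>2" by simp
  finally have "norm (w - c) < 2" by (rule power2_less_imp_less) simp
  then show "w \<in> hull_box c 2"
    unfolding hull_box_def using Cauchy_Schwarz_ineq2[of "w - c"] norm_hull_basis
    by (fastforce intro: le_less_trans)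
qed

section \<open>Derivatives and quadratic bounds of the loss\<close>

text \<open>The difference of the two sides is monotone on each side of $0$: its derivative is
$u(3+8u)/(5(1+u))$, and $3 + 8u > 0$ on this range.\<close>

lemma neg_ln_quadratic_upper:
  fixes u :: real
  assumes "\<bar>u\<bar> < 1 / 4"
  shows "- ln (1 + u) \<le> - u + 4 / 5 * u\<^sup>2"
proof -
  define f where "f = (\<lambda>u::real. - u + 4 / 5 * u\<^sup>2 + ln (1 + u))"
  have D: "(f has_real_derivative (- 1 + 8 / 5 * u + 1 / (1 + u))) (at u)" if "\<bar>u\<bar> < 1 / 4" for u
    unfolding f_def using that by (auto intro!: derivative_eq_intros)
  have D': "- 1 + 8 / 5 * u + 1 / (1 + u) = u * (3 + 8 * u) / (5 * (1 + u))" if "\<bar>u\<bar> < 1 / 4" for u :: real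
    using that by (auto simp: field_simps)
  have "f 0 \<le> f u"
  proof (cases "0 \<le> u")
    case True
    show ?thesis
    proof (rule DERIV_nonneg_imp_nondecreasing[OF True])
      fix y assume "0 \<le> y" "y \<le> u"
      then show "\<exists>z. (f has_real_derivative z) (at y) \<and> 0 \<le> z"
        using D[of y] D'[of y] assms by (intro exI[of _ "- 1 + 8 / 5 * y + 1 / (1 + y)"]) auto
    qed
  next
    case False
    then have "u \<le> 0" by simp
    then show ?thesis
    proof (rule DERIV_nonpos_imp_nonincreasing)
      fix y assume "u \<le> y" "y \<le> 0"
      then show "\<exists>z. (f has_real_derivative z) (at y) \<and> z \<le> 0"
        using D[of y] D'[of y] assms
        by (intro exI[of _ "- 1 + 8 / 5 * y + 1 / (1 + y)"]) (auto intro!: divide_nonpos_pos mult_nonpos_nonneg)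
    qed
  qed
  then show ?thesis by (simp add: f_def)
qed

locale log_loss =
  fixes x :: "nat \<Rightarrow> real ^ 'n" and lam :: real and s :: nat
  assumes x_nonneg: "\<tau> \<in> {1..s} \<Longrightarrow> 0 \<le> x \<tau> $ i"
    and x_nonzero: "\<tau> \<in> {1..s} \<Longrightarrow> x \<tau> \<noteq> 0"
    and lam_ge_1: "1 \<le> lam"
begin

lemma lam_pos: "0 < lam" using lam_ge_1 by simp

lemma inner_pos:
  assumes "\<tau> \<in> {1..s}" "\<forall>i. 0 < u $ i" shows "0 < x \<tau> \<bullet> u"
proof -
  obtain i where "x \<tau> $ i \<noteq> 0" using x_nonzero[OF assms(1)] by (auto simp: vec_eq_iff)
  then have "0 < x \<tau> $ i * u $ i"
    using x_nonneg[OF assms(1), of i] assms(2) by (simp add: less_le)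
  then show ?thesis
    unfolding inner_vec_def using x_nonneg[OF assms(1)] assms(2)
    by (auto intro!: sum_pos2[of _ i] mult_nonneg_nonneg simp: less_imp_le)
qed

text \<open>The gradient $\nabla L(u)^\top h$ and the Hessian form $h^\top \nabla^2 L(u) h$ in closed form.\<close>

definition loss_grad :: "real ^ 'n \<Rightarrow> real ^ 'n \<Rightarrow> real" where
  "loss_grad u h = - (\<Sum>\<tau>\<in>{1..s}. (x \<tau> \<bullet> h) / (x \<tau> \<bullet> u)) - lam * (\<Sum>i\<in>UNIV. h $ i / u $ i)"

definition loss_curv :: "real ^ 'n \<Rightarrow> real ^ 'n \<Rightarrow> real" where
  "loss_curv u h = (\<Sum>\<tau>\<in>{1..s}. ((x \<tau> \<bullet> h) / (x \<tau> \<bullet> u))\<^sup>2) + lam * (\<Sum>i\<in>UNIV. (h $ i / u $ i)\<^sup>2)"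

lemma loss_fin_has_derivative:
  assumes "\<forall>i. 0 < u $ i"
  shows "(loss_fin lam x s has_derivative loss_grad u) (at u)"
  unfolding loss_fin_def[abs_def] loss_grad_def[abs_def]
  using assms inner_pos[OF _ assms]
  by (auto intro!: derivative_eq_intros bounded_linear_imp_has_derivative[OF bounded_linear_vec_nth] simp: fun_eq_iff sum_negf divide_inverse mult_ac)

lemma loss_grad_has_derivative:
  assumes "\<forall>i. 0 < u $ i"
  shows "((\<lambda>u. loss_grad u g) has_derivative
     (\<lambda>h. (\<Sum>\<tau>\<in>{1..s}. (x \<tau> \<bullet> g) * (x \<tau> \<bullet> h) / (x \<tau> \<bullet> u)\<^sup>2) + lam * (\<Sum>i\<in>UNIV. g $ i * h $ i / (u $ i)\<^sup>2))) (at u)"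
  unfolding loss_grad_def[abs_def]
  using assms inner_pos[OF _ assms]
  by (auto intro!: derivative_eq_intros bounded_linear_imp_has_derivative[OF bounded_linear_vec_nth] sum.cong arg_cong2[where f="(+)"] simp: fun_eq_iff sum_negf divide_inverse mult_ac power2_eq_square less_imp_neq[symmetric] sum_distrib_left)

lemma open_pos: "open {w :: real ^ 'n. \<forall>i. 0 < w $ i}"
  unfolding Collect_all_eq by (intro open_INT finite ballI open_Collect_less continuous_intros)

lemma hessian_entry:
  assumes w: "\<forall>i. 0 < w $ i"
  shows "hessian (loss_fin lam x s) w $ i $ j =
    (\<Sum>\<tau>\<in>{1..s}. x \<tau> $ j * x \<tau> $ i / (x \<tau> \<bullet> w)\<^sup>2) + (if i = j then lam / (w $ i)\<^sup>2 else 0)"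
proof -
  have D: "((\<lambda>u. frechet_derivative (loss_fin lam x s) (at u) (axis j 1)) has_derivative
     (\<lambda>h. (\<Sum>\<tau>\<in>{1..s}. (x \<tau> \<bullet> axis j 1) * (x \<tau> \<bullet> h) / (x \<tau> \<bullet> w)\<^sup>2)
        + lam * (\<Sum>i\<in>UNIV. axis j 1 $ i * h $ i / (w $ i)\<^sup>2))) (at w)"
  proof (rule has_derivative_transform_within_open[OF loss_grad_has_derivative[OF w] open_pos])
    show "w \<in> {w. \<forall>i. 0 < w $ i}" using w by simp
    show "loss_grad u (axis j 1) = frechet_derivative (loss_fin lam x s) (at u) (axis j 1)"
      if "u \<in> {w. \<forall>i. 0 < w $ i}" for u
      using loss_fin_has_derivative[of u] frechet_derivative_at that by fastforce
  qed
  have "hessian (loss_fin lam x s) w $ i $ j =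
      (\<Sum>\<tau>\<in>{1..s}. (x \<tau> \<bullet> axis j 1) * (x \<tau> \<bullet> axis i 1) / (x \<tau> \<bullet> w)\<^sup>2)
        + lam * (\<Sum>k\<in>UNIV. axis j 1 $ k * axis i 1 $ k / (w $ k)\<^sup>2)"
    unfolding hessian_def by (simp add: frechet_derivative_at[OF D, symmetric])
  also have "(\<Sum>k\<in>UNIV. axis j 1 $ k * axis i 1 $ k / (w $ k)\<^sup>2) = (\<Sum>k\<in>UNIV. if k = i then (if i = j then 1 / (w $ i)\<^sup>2 else 0) else 0)"
    by (intro sum.cong) (auto simp: axis_def)
  finally show ?thesis by (simp add: inner_axis)
qed

lemma hessian_quadratic_form:
  assumes w: "\<forall>i. 0 < w $ i"
  shows "v \<bullet> (hessian (loss_fin lam x s) w *v v) = loss_curv w v"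
proof -
  let ?H = "hessian (loss_fin lam x s) w"
  have "v \<bullet> (?H *v v) = (\<Sum>i\<in>UNIV. \<Sum>j\<in>UNIV. v $ i * (?H $ i $ j * v $ j))"
    by (simp add: inner_vec_def matrix_vector_mult_def sum_distrib_left)
  also have "\<dots> = (\<Sum>i\<in>UNIV. \<Sum>j\<in>UNIV. (\<Sum>\<tau>\<in>{1..s}. (x \<tau> $ i * v $ i) * (x \<tau> $ j * v $ j) / (x \<tau> \<bullet> w)\<^sup>2)
      + (if i = j then lam * (v $ i / w $ i)\<^sup>2 else 0))"
    by (intro sum.cong)
      (auto simp: hessian_entry[OF w] algebra_simps sum_distrib_left sum_distrib_right power_divide power2_eq_square intro!: sum.cong)
  also have "\<dots> = (\<Sum>i\<in>UNIV. \<Sum>j\<in>UNIV. \<Sum>\<tau>\<in>{1..s}. (x \<tau> $ i * v $ i) * (x \<tau> $ j * v $ j) / (x \<tau> \<bullet> w)\<^sup>2)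
      + lam * (\<Sum>i\<in>UNIV. (v $ i / w $ i)\<^sup>2)"
    by (simp add: sum.distrib sum_distrib_left)
  also have "(\<Sum>i\<in>UNIV. \<Sum>j\<in>UNIV. \<Sum>\<tau>\<in>{1..s}. (x \<tau> $ i * v $ i) * (x \<tau> $ j * v $ j) / (x \<tau> \<bullet> w)\<^sup>2)
      = (\<Sum>\<tau>\<in>{1..s}. \<Sum>i\<in>UNIV. \<Sum>j\<in>UNIV. (x \<tau> $ i * v $ i) * (x \<tau> $ j * v $ j) / (x \<tau> \<bullet> w)\<^sup>2)"
    by (subst (2) sum.swap, subst sum.swap) simp
  also have "\<dots> = (\<Sum>\<tau>\<in>{1..s}. ((x \<tau> \<bullet> v) / (x \<tau> \<bullet> w))\<^sup>2)"
    by (simp add: power_divide inner_vec_def[of _ v] power2_eq_square sum_product sum_divide_distrib)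
  finally show ?thesis unfolding loss_curv_def .
qed

lemma dikin_iff:
  assumes "\<forall>i. 0 < c $ i"
  shows "w \<in> dikin lam x s r c \<longleftrightarrow> w \<in> simplex_hull \<and> loss_curv c (w - c) < r\<^sup>2"
  by (simp add: dikin_def hessian_quadratic_form[OF assms])

text \<open>Since $\lambda \ge 1$, each squared relative change is bounded by the whole Hessian form; this is where
the lower bound on $\lambda$ enters the analysis of the Dikin ellipsoid.\<close>

lemma loss_curv_bounds_terms:
  assumes "loss_curv c h < r\<^sup>2" "0 \<le> r"
  shows "\<bar>h $ i / c $ i\<bar> < r" and "\<tau> \<in> {1..s} \<Longrightarrow> \<bar>(x \<tau> \<bullet> h) / (x \<tau> \<bullet> c)\<bar> < r"
proof -
  let ?A = "\<Sum>\<tau>\<in>{1..s}. ((x \<tau> \<bullet> h) / (x \<tau> \<bullet> c))\<^sup>2" and ?B = "\<Sum>i\<in>UNIV. (h $ i / c $ i)\<^sup>2"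
  have A: "0 \<le> ?A" and B: "0 \<le> ?B" by (auto intro!: sum_nonneg)
  have "?B \<le> lam * ?B" using mult_right_mono[OF lam_ge_1 B] by simp
  then have AB: "?A + ?B < r\<^sup>2" using assms(1) unfolding loss_curv_def by linarith
  have "(h $ i / c $ i)\<^sup>2 \<le> ?B" by (intro member_le_sum) auto
  then have "\<bar>h $ i / c $ i\<bar>\<^sup>2 < r\<^sup>2" unfolding power2_abs using A AB by linarith
  then show "\<bar>h $ i / c $ i\<bar> < r" using assms(2) by (rule power2_less_imp_less)
  assume "\<tau> \<in> {1..s}"
  then have "((x \<tau> \<bullet> h) / (x \<tau> \<bullet> c))\<^sup>2 \<le> ?A" by (intro member_le_sum) auto
  then have "\<bar>(x \<tau> \<bullet> h) / (x \<tau> \<bullet> c)\<bar>\<^sup>2 < r\<^sup>2" unfolding power2_abs using B AB by linarith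
  then show "\<bar>(x \<tau> \<bullet> h) / (x \<tau> \<bullet> c)\<bar> < r" using assms(2) by (rule power2_less_imp_less)
qed

lemma dikin_subset_pos:
  assumes c: "\<forall>i. 0 < c $ i" and curv: "loss_curv c (w - c) < (1/4)\<^sup>2"
  shows "0 < w $ i"
proof -
  have "\<bar>(w - c) $ i / c $ i\<bar> < 1/4" by (rule loss_curv_bounds_terms[OF curv]) simp
  then have "- ((w $ i - c $ i) / c $ i) < 1/4" by (simp only: vector_minus_component)
  then show ?thesis using c[rule_format, of i] by (simp add: field_simps)
qed

text \<open>Exact expansion in the relative changes of the linear forms; the tangent bound and the quadratic upper
bound both follow from it term by term.\<close>

lemma loss_fin_expand:
  assumes c: "\<forall>i. 0 < c $ i" and w: "\<forall>i. 0 < w $ i"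
  shows "loss_fin lam x s w = loss_fin lam x s c
    + (\<Sum>\<tau>\<in>{1..s}. - ln (1 + (x \<tau> \<bullet> (w - c)) / (x \<tau> \<bullet> c)))
    + lam * (\<Sum>i\<in>UNIV. - ln (1 + (w - c) $ i / c $ i))"
proof -
  have "ln (x \<tau> \<bullet> w) = ln (x \<tau> \<bullet> c) + ln (1 + (x \<tau> \<bullet> (w - c)) / (x \<tau> \<bullet> c))" if "\<tau> \<in> {1..s}" for \<tau>
    using inner_pos[OF that c] inner_pos[OF that w]
    by (simp add: inner_diff_right divide_simps flip: ln_mult_pos)
  moreover have "ln (w $ i) = ln (c $ i) + ln (1 + (w - c) $ i / c $ i)" for i
    using c[rule_format, of i] w[rule_format, of i] by (simp add: divide_simps flip: ln_mult_pos)
  ultimately show ?thesis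
    unfolding loss_fin_def
    by (simp add: sum.distrib sum_negf sum_subtractf right_diff_distrib distrib_left cong: sum.cong_simp)
qed

lemma loss_fin_ge_tangent:
  assumes c: "\<forall>i. 0 < c $ i" and w: "\<forall>i. 0 < w $ i"
  shows "loss_fin lam x s c + loss_grad c (w - c) \<le> loss_fin lam x s w"
proof -
  let ?u = "\<lambda>\<tau>. (x \<tau> \<bullet> (w - c)) / (x \<tau> \<bullet> c)" and ?v = "\<lambda>i. (w - c) $ i / c $ i"
  have "- 1 < ?u \<tau>" if "\<tau> \<in> {1..s}" for \<tau>
    using inner_pos[OF that c] inner_pos[OF that w] by (simp add: inner_diff_right field_simps)
  moreover have "- 1 < ?v i" for i
    using c[rule_format, of i] w[rule_format, of i] by (simp add: field_simps)
  ultimately have "loss_fin lam x s c + (\<Sum>\<tau>\<in>{1..s}. - ?u \<tau>) + lam * (\<Sum>i\<in>UNIV. - ?v i) \<le> loss_fin lam x s w"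
    unfolding loss_fin_expand[OF c w] using lam_pos
    by (intro add_mono order_refl sum_mono mult_left_mono le_imp_neg_le ln_add_one_self_le_self2) auto
  then show ?thesis unfolding loss_grad_def by (simp add: sum_negf)
qed

lemma loss_fin_le_quadratic:
  assumes c: "\<forall>i. 0 < c $ i" and curv: "loss_curv c (w - c) < (1/4)\<^sup>2"
  shows "loss_fin lam x s w \<le> loss_fin lam x s c + loss_grad c (w - c) + 4 / 5 * loss_curv c (w - c)"
proof -
  have w: "\<forall>i. 0 < w $ i" using dikin_subset_pos[OF c curv] by simp
  let ?u = "\<lambda>\<tau>. (x \<tau> \<bullet> (w - c)) / (x \<tau> \<bullet> c)" and ?v = "\<lambda>i. (w - c) $ i / c $ i"
  have "loss_fin lam x s w \<le> loss_fin lam x s c + (\<Sum>\<tau>\<in>{1..s}. - ?u \<tau> + 4/5 * (?u \<tau>)\<^sup>2)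
    + lam * (\<Sum>i\<in>UNIV. - ?v i + 4/5 * (?v i)\<^sup>2)"
    unfolding loss_fin_expand[OF c w] using lam_pos loss_curv_bounds_terms[OF curv]
    by (intro add_mono order_refl sum_mono mult_left_mono neg_ln_quadratic_upper) auto
  also have "\<dots> = loss_fin lam x s c + loss_grad c (w - c) + 4 / 5 * loss_curv c (w - c)"
    unfolding loss_grad_def loss_curv_def by (simp only: sum.distrib sum_negf sum_distrib_left[symmetric]) (simp add: algebra_simps)
  finally show ?thesis .
qed

end

section \<open>Laws with a density, extended expectations and covariances\<close>

lemma sets_law [simp, measurable_cong]: "sets (law \<phi>) = sets borel"
  and space_law [simp]: "space (law \<phi>) = UNIV"
  by (simp_all add: law_def)

lemma Supp_measurable: "\<phi> \<in> Supp S \<Longrightarrow> \<phi> \<in> borel_measurable borel"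
  and Supp_nonneg: "\<phi> \<in> Supp S \<Longrightarrow> 0 \<le> \<phi> w"
  by (simp_all add: Supp_def)

lemma Supp_mono: "S \<subseteq> S' \<Longrightarrow> Supp S \<subseteq> Supp S'"
  by (auto simp: Supp_def elim!: eventually_mono)

lemma emeasure_law_UNIV:
  assumes "\<phi> \<in> Supp S" shows "emeasure (law \<phi>) UNIV = 1"
proof -
  have "(\<lambda>w. ennreal (\<phi> w)) \<in> borel_measurable hull_lborel"
    using Supp_measurable[OF assms] by measurable
  then show ?thesis using assms by (simp add: law_def emeasure_density Supp_def)
qed

lemma finite_measure_law:
  assumes "\<phi> \<in> Supp S" shows "finite_measure (law \<phi>)"
  using emeasure_law_UNIV[OF assms] by (intro finite_measureI) simp

lemma integral_law_const:
  assumes "\<phi> \<in> Supp S" shows "(\<integral>w. (a::real) \<partial>law \<phi>) = a"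
  using emeasure_law_UNIV[OF assms] by (simp add: measure_def)

lemma AE_law:
  assumes "\<phi> \<in> Supp S"
  shows "AE w in law \<phi>. w \<in> S \<and> w \<in> simplex_hull \<and> 0 < \<phi> w"
proof -
  have "AE w in hull_lborel. w \<notin> S \<longrightarrow> \<phi> w = 0" using assms by (simp add: Supp_def)
  with AE_hull_lborel_in_hull have "AE w in hull_lborel. 0 < ennreal (\<phi> w) \<longrightarrow> w \<in> S \<and> w \<in> simplex_hull \<and> 0 < \<phi> w"
    by eventually_elim auto
  then show ?thesis
    unfolding law_def using Supp_measurable[OF assms] by (subst AE_density) auto
qed

lemma integral_law:
  fixes h :: "real ^ 'n \<Rightarrow> 'b :: {banach, second_countable_topology}"
  assumes "\<phi> \<in> Supp S" "h \<in> borel_measurable borel"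
  shows "integral\<^sup>L (law \<phi>) h = (\<integral>w. \<phi> w *\<^sub>R h w \<partial>hull_lborel)"
    and "integrable (law \<phi>) h \<longleftrightarrow> integrable hull_lborel (\<lambda>w. \<phi> w *\<^sub>R h w)"
  unfolding law_def using assms Supp_measurable[OF assms(1)] Supp_nonneg[OF assms(1)]
  by (auto simp: integral_density integrable_density)

text \<open>The extended expectation is not additive in general, being a difference of possibly infinite
quantities. All computations with finite expectations therefore go through
Bochner integrals of real representatives, which the next two lemmas supply.\<close>

lemma ext_expectation_eq_integral:
  assumes "integrable M g" "AE w in M. f w = ereal (g w)"
  shows "ext_expectation M f = ereal (integral\<^sup>L M g)"
proof -
  have "(\<integral>\<^sup>+w. e2ennreal (f w) \<partial>M) = (\<integral>\<^sup>+w. ennreal (g w) \<partial>M)"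
    by (rule nn_integral_cong_AE) (use assms(2) in \<open>auto simp: e2ennreal_ereal\<close>)
  moreover have "(\<integral>\<^sup>+w. e2ennreal (- f w) \<partial>M) = (\<integral>\<^sup>+w. ennreal (- g w) \<partial>M)"
    by (rule nn_integral_cong_AE) (use assms(2) in \<open>auto simp: e2ennreal_ereal\<close>)
  moreover have fin: "(\<integral>\<^sup>+w. ennreal (g w) \<partial>M) \<noteq> \<infinity>" "(\<integral>\<^sup>+w. ennreal (- g w) \<partial>M) \<noteq> \<infinity>"
    using assms(1) by (auto simp: real_integrable_def)
  ultimately show ?thesis
    unfolding ext_expectation_def real_lebesgue_integral_def[OF assms(1)]
    by (cases "\<integral>\<^sup>+w. ennreal (g w) \<partial>M"; cases "\<integral>\<^sup>+w. ennreal (- g w) \<partial>M") auto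
qed

lemma integrable_of_ext_expectation_parts:
  assumes [measurable]: "f \<in> borel_measurable M"
    and pos: "(\<integral>\<^sup>+w. e2ennreal (f w) \<partial>M) \<noteq> \<infinity>" and neg: "(\<integral>\<^sup>+w. e2ennreal (- f w) \<partial>M) \<noteq> \<infinity>"
  shows "integrable M (\<lambda>w. real_of_ereal (f w))"
    and "AE w in M. f w = ereal (real_of_ereal (f w))"
proof -
  have "ennreal (real_of_ereal y) \<le> e2ennreal y" "ennreal (- real_of_ereal y) \<le> e2ennreal (- y)" for y
    by (cases y; simp add: e2ennreal_ereal)+
  then have "(\<integral>\<^sup>+w. ennreal (real_of_ereal (f w)) \<partial>M) \<le> (\<integral>\<^sup>+w. e2ennreal (f w) \<partial>M)"
    and "(\<integral>\<^sup>+w. ennreal (- real_of_ereal (f w)) \<partial>M) \<le> (\<integral>\<^sup>+w. e2ennreal (- f w) \<partial>M)"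
    by (auto intro!: nn_integral_mono)
  then show "integrable M (\<lambda>w. real_of_ereal (f w))"
    using pos neg by (auto simp: real_integrable_def top_unique)
  have "AE w in M. e2ennreal (f w) \<noteq> \<infinity>" "AE w in M. e2ennreal (- f w) \<noteq> \<infinity>"
    by (rule nn_integral_PInf_AE[OF _ pos], measurable, rule nn_integral_PInf_AE[OF _ neg], measurable)
  then show "AE w in M. f w = ereal (real_of_ereal (f w))"
  proof eventually_elim
    case (elim w)
    then show ?case by (cases "f w") auto
  qed
qed

lemma integrable_law_continuous:
  assumes \<phi>: "\<phi> \<in> Supp S" "S \<subseteq> std_simplex" and h: "continuous_on UNIV h"
  shows "integrable (law \<phi>) (h :: real ^ 'n \<Rightarrow> 'b :: {banach, second_countable_topology})"
proof -
  interpret finite_measure "law \<phi>" by (rule finite_measure_law) fact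
  have "compact (h ` std_simplex)"
    using compact_std_simplex h by (intro compact_continuous_image) (auto intro: continuous_on_subset)
  then obtain B where B: "\<And>w. w \<in> std_simplex \<Longrightarrow> norm (h w) \<le> B"
    using compact_imp_bounded bounded_iff by (metis imageI)
  show ?thesis
  proof (rule integrable_const_bound)
    show "AE w in law \<phi>. norm (h w) \<le> B" using AE_law[OF \<phi>(1)] \<phi>(2) B by (auto elim!: eventually_mono)
    show "h \<in> borel_measurable (law \<phi>)" using borel_measurable_continuous_onI[OF h] by simp
  qed
qed

text \<open>Written as an expectation of a quadratic form, the trace term of the surrogate can be compared
pointwise with the loss and bounded by the radius of the Dikin ellipsoid.\<close>

lemma trace_mult_Cov:
  fixes H :: "real ^ 'n ^ 'n"
  assumes \<phi>: "\<phi> \<in> Supp S" "S \<subseteq> std_simplex"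
  shows "trace (H ** Cov \<phi>) = (\<integral>w. (w - mean \<phi>) \<bullet> (H *v (w - mean \<phi>)) \<partial>law \<phi>)"
proof -
  let ?m = "mean \<phi>"
  have I: "integrable (law \<phi>) (\<lambda>w. H $ i $ k * ((w $ k - ?m $ k) * (w $ i - ?m $ i)))" for i k
    by (rule integrable_law_continuous[OF \<phi>]) (intro continuous_intros)
  have "trace (H ** Cov \<phi>) = (\<Sum>i\<in>UNIV. \<Sum>k\<in>UNIV. \<integral>w. H $ i $ k * ((w $ k - ?m $ k) * (w $ i - ?m $ i)) \<partial>law \<phi>)"
    by (simp add: trace_def matrix_matrix_mult_def Cov_def)
  also have "\<dots> = (\<integral>w. (\<Sum>i\<in>UNIV. \<Sum>k\<in>UNIV. H $ i $ k * ((w $ k - ?m $ k) * (w $ i - ?m $ i))) \<partial>law \<phi>)"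
    by (subst Bochner_Integration.integral_sum, (intro Bochner_Integration.integrable_sum I),
        intro sum.cong refl, subst Bochner_Integration.integral_sum, (intro I), rule refl)
  also have "\<dots> = (\<integral>w. (w - ?m) \<bullet> (H *v (w - ?m)) \<partial>law \<phi>)"
    by (simp add: inner_vec_def matrix_vector_mult_def sum_distrib_left mult_ac)
  finally show ?thesis .
qed

section \<open>Domination of the objective by the surrogate\<close>

context log_loss begin

lemma loss_fin_measurable [measurable]: "loss_fin lam x s \<in> borel_measurable borel"
  unfolding loss_fin_def[abs_def] by measurable

lemma pos_borel [measurable]: "{w :: real ^ 'n. \<forall>i. 0 < w $ i} \<in> sets borel"
  using open_pos by simp

lemma loss_measurable [measurable]: "loss lam x s \<in> borel_measurable borel"
proof -
  have "loss lam x s = (\<lambda>w. if w \<in> {w. \<forall>i. 0 < w $ i} then ereal (loss_fin lam x s w) else \<infinity>)"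
    by (auto simp: loss_def fun_eq_iff)
  also have "\<dots> \<in> borel_measurable borel" by measurable
  finally show ?thesis .
qed

lemma bounded_linear_loss_grad:
  "\<forall>i. 0 < c $ i \<Longrightarrow> bounded_linear (loss_grad c)"
  using loss_fin_has_derivative has_derivative_bounded_linear by blast

lemma dikin_subset_simplex:
  assumes "\<forall>i. 0 < c $ i" shows "dikin lam x s (1 / 4) c \<subseteq> std_simplex"
  using dikin_subset_pos[OF assms] dikin_iff[OF assms] by (auto simp: std_simplex_iff less_imp_le)

lemma trace_hessian_Cov:
  assumes c: "\<forall>i. 0 < mean \<phi> $ i" and \<phi>: "\<phi> \<in> Supp S" "S \<subseteq> std_simplex"
  shows "trace (hessian (loss_fin lam x s) (mean \<phi>) ** Cov \<phi>) = (\<integral>w. loss_curv (mean \<phi>) (w - mean \<phi>) \<partial>law \<phi>)"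
  unfolding trace_mult_Cov[OF \<phi>] hessian_quadratic_form[OF c] ..

lemma continuous_on_loss_curv: "continuous_on UNIV (\<lambda>w. loss_curv c (w - c))"
  unfolding loss_curv_def divide_inverse by (intro continuous_intros)

text \<open>The entropy is the same on both sides, so it may be infinite. The loss itself is integrable because
on the Dikin ellipsoid it differs from its linearisation, which is integrable, by a bounded amount.\<close>

lemma F_le_Fbar:
  assumes "\<phi> \<in> feasible lam x s"
  shows "F \<mu> lam x s \<phi> \<le> Fbar \<mu> lam x s \<phi>"
proof -
  let ?L = "loss_fin lam x s" and ?c = "mean \<phi>" and ?D = "dikin lam x s (1 / 4) (mean \<phi>)"
  have c: "\<forall>i. 0 < ?c $ i" and \<phi>: "\<phi> \<in> Supp ?D"
    using assms by (auto simp: feasible_def rel_interior_std_simplex_iff)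
  note sub = dikin_subset_simplex[OF c]
  interpret finite_measure "law \<phi>" by (rule finite_measure_law[OF \<phi>])
  have D: "AE w in law \<phi>. loss_curv ?c (w - ?c) < (1/4)\<^sup>2"
    using AE_law[OF \<phi>] by (auto simp: dikin_iff[OF c] elim!: eventually_mono)
  let ?g = "\<lambda>w. loss_grad ?c (w - ?c)"
  have lin: "bounded_linear (loss_grad ?c)" by (rule bounded_linear_loss_grad[OF c])
  have id: "integrable (law \<phi>) (\<lambda>w. w)"
    by (rule integrable_law_continuous[OF \<phi> sub]) (intro continuous_intros)
  have diff: "integrable (law \<phi>) (\<lambda>w. w - ?c)"
    by (rule integrable_law_continuous[OF \<phi> sub]) (intro continuous_intros)
  have "(\<integral>w. w - ?c \<partial>law \<phi>) = 0"
    using id emeasure_law_UNIV[OF \<phi>] by (subst Bochner_Integration.integral_diff) (auto simp: mean_def measure_def)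
  then have mean0: "(\<integral>w. ?g w \<partial>law \<phi>) = 0"
    using integral_bounded_linear[OF lin diff] linear_0[OF bounded_linear.linear[OF lin]] by simp
  have Ig: "integrable (law \<phi>) ?g" by (rule integrable_bounded_linear[OF lin diff])
  have Ic: "integrable (law \<phi>) (\<lambda>w. loss_curv ?c (w - ?c))"
    by (rule integrable_law_continuous[OF \<phi> sub continuous_on_loss_curv])
  have bounds: "AE w in law \<phi>. ?L ?c + ?g w \<le> ?L w \<and> ?L w \<le> ?L ?c + ?g w + 4/5 * loss_curv ?c (w - ?c)"
    using D by eventually_elim
      (use loss_fin_ge_tangent[OF c] loss_fin_le_quadratic[OF c] dikin_subset_pos[OF c] in blast)
  have "integrable (law \<phi>) (\<lambda>w. ?L w - (?L ?c + ?g w))"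
  proof (rule integrable_const_bound)
    show "AE w in law \<phi>. norm (?L w - (?L ?c + ?g w)) \<le> 1"
      using bounds D by eventually_elim (auto simp: power2_eq_square)
    show "(\<lambda>w. ?L w - (?L ?c + ?g w)) \<in> borel_measurable (law \<phi>)"
      using Ig by (intro borel_measurable_diff borel_measurable_add) auto
  qed
  then have "integrable (law \<phi>) (\<lambda>w. (?L w - (?L ?c + ?g w)) + (?L ?c + ?g w))"
    using Ig by (intro Bochner_Integration.integrable_add) auto
  then have IL: "integrable (law \<phi>) ?L" by simp
  have "AE w in law \<phi>. loss lam x s w = ereal (?L w)"
    using D by eventually_elim (use dikin_subset_pos[OF c] in \<open>auto simp: loss_def\<close>)
  then have E: "ext_expectation (law \<phi>) (loss lam x s) = ereal (\<integral>w. ?L w \<partial>law \<phi>)"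
    by (rule ext_expectation_eq_integral[OF IL])
  have "(\<integral>w. ?L w \<partial>law \<phi>) \<le> (\<integral>w. ?L ?c + ?g w + 4/5 * loss_curv ?c (w - ?c) \<partial>law \<phi>)"
    using bounds IL Ig Ic by (intro integral_mono_AE) (auto elim!: eventually_mono)
  also have "\<dots> = ?L ?c + 4/5 * (\<integral>w. loss_curv ?c (w - ?c) \<partial>law \<phi>)"
    using Ig Ic mean0 integral_law_const[OF \<phi>] by simp
  finally have "ext_expectation (law \<phi>) (loss lam x s)
      \<le> loss lam x s ?c + ereal (4 / 5 * trace (hessian ?L ?c ** Cov \<phi>))"
    unfolding E trace_hessian_Cov[OF c \<phi> sub] using c by (simp add: loss_def)
  then show ?thesis
    unfolding F_def Fbar_def by (intro ereal_minus_mono) auto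
qed

section \<open>The minimiser of the loss over the simplex\<close>

text \<open>The loss is infinite on the boundary, so compactness is applied to $e^{-L}$, a product of powers of
linear forms that extends continuously to the whole simplex and vanishes on its boundary.\<close>

lemma ex_loss_minimiser:
  "\<exists>c. (\<forall>i. 0 < c $ i) \<and> c \<in> simplex_hull \<and>
     (\<forall>w\<in>simplex_hull. (\<forall>i. 0 < w $ i) \<longrightarrow> loss_fin lam x s c \<le> loss_fin lam x s w)"
proof -
  define G where "G w = (\<Prod>\<tau>\<in>{1..s}. x \<tau> \<bullet> w) * (\<Prod>i\<in>UNIV. w $ i powr lam)" for w
  have exp_loss: "G w = exp (- loss_fin lam x s w)" if "\<forall>i. 0 < w $ i" for w
  proof -
    have "exp (- loss_fin lam x s w) = exp (\<Sum>\<tau>\<in>{1..s}. ln (x \<tau> \<bullet> w)) * exp (\<Sum>i\<in>UNIV. lam * ln (w $ i))"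
      by (simp add: loss_fin_def sum_negf sum_distrib_left flip: exp_add)
    also have "\<dots> = G w"
      unfolding G_def exp_sum[OF finite_atLeastAtMost] exp_sum[OF finite] using that inner_pos[OF _ that]
      by (intro arg_cong2[where f="(*)"] prod.cong refl) (auto simp: powr_def less_imp_neq[symmetric])
    finally show ?thesis by simp
  qed
  have "continuous_on std_simplex G"
    unfolding G_def using lam_pos
    by (intro continuous_intros continuous_on_powr') (auto simp: std_simplex_def)
  then obtain c where c: "c \<in> std_simplex" "\<And>w. w \<in> std_simplex \<Longrightarrow> G w \<le> G c"
    using continuous_attains_sup[OF compact_std_simplex, of G] axis_in_simplex by (metis empty_iff)
  have "G (\<chi> i. 1 / real CARD('n)) \<le> G c" by (rule c(2)) (simp add: std_simplex_def)
  moreover have "0 < G (\<chi> i. 1 / real CARD('n))" by (subst exp_loss) simp_all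
  ultimately have "G c \<noteq> 0" by linarith
  then have "c $ i \<noteq> 0" for i unfolding G_def mult_eq_0_iff prod_zero_iff[OF finite] by auto
  then have pos: "\<forall>i. 0 < c $ i" using c(1) by (auto simp: std_simplex_def less_le)
  have "loss_fin lam x s c \<le> loss_fin lam x s w" if "w \<in> simplex_hull" "\<forall>i. 0 < w $ i" for w
    using c(2)[of w] that pos by (auto simp: exp_loss std_simplex_iff less_imp_le)
  then show ?thesis using pos c(1) by (auto simp: std_simplex_iff)
qed

end

locale log_loss_minimiser = log_loss x lam s for x :: "nat \<Rightarrow> real ^ 'n" and lam s +
  fixes c :: "real ^ 'n"
  assumes c_pos: "0 < c $ i" and c_hull: "c \<in> simplex_hull"
    and c_min: "w \<in> simplex_hull \<Longrightarrow> (\<forall>i. 0 < w $ i) \<Longrightarrow> loss_fin lam x s c \<le> loss_fin lam x s w"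
begin

lemma c_pos_all: "\<forall>i. 0 < c $ i" using c_pos by simp

lemma c_simplex: "c \<in> std_simplex"
  using c_pos c_hull by (simp add: std_simplex_iff less_imp_le)

lemma loss_grad_minimiser:
  assumes "v \<in> hull_directions" shows "loss_grad c v = 0"
proof -
  let ?l = "\<lambda>\<epsilon>. c + \<epsilon> *\<^sub>R v"
  have op: "open {\<epsilon>. \<forall>i. 0 < ?l \<epsilon> $ i}"
    unfolding Collect_all_eq by (intro open_INT finite ballI open_Collect_less continuous_intros)
  have "0 \<in> {\<epsilon>. \<forall>i. 0 < ?l \<epsilon> $ i}" using c_pos by simp
  from openE[OF op this] obtain d where d: "d > 0" "ball 0 d \<subseteq> {\<epsilon>. \<forall>i. 0 < ?l \<epsilon> $ i}" .
  have hull: "?l \<epsilon> \<in> simplex_hull" for \<epsilon>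
    using c_hull assms by (simp add: simplex_hull_def hull_directions_def sum.distrib flip: sum_distrib_left)
  have "(loss_fin lam x s has_derivative loss_grad c) (at (?l 0))"
    using loss_fin_has_derivative[OF c_pos_all] by simp
  then have "((\<lambda>\<epsilon>. loss_fin lam x s (?l \<epsilon>)) has_derivative (\<lambda>h. loss_grad c (h *\<^sub>R v))) (at 0)"
    by (rule has_derivative_compose[rotated]) (auto intro!: derivative_eq_intros)
  then have "((\<lambda>\<epsilon>. loss_fin lam x s (?l \<epsilon>)) has_real_derivative loss_grad c v) (at 0)"
    unfolding has_field_derivative_def
    by (simp only: linear_cmul[OF bounded_linear.linear[OF bounded_linear_loss_grad[OF c_pos_all]]]
        real_scaleR_def mult.commute[of _ "loss_grad c v"])
  then show ?thesis
    by (rule DERIV_local_min[OF _ d(1)]) (use d(2) c_min hull in \<open>auto simp: dist_real_def subset_iff\<close>)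
qed

text \<open>Up to sign, the Lagrange multiplier of the constraint $\sum_i w[i] = 1$ at the minimiser.\<close>

definition N :: real where "N = real s + lam * real CARD('n)"

text \<open>The gradient vanishes in the direction from the minimiser to a vertex. Homogeneity supplies the value
$N$: pairing the gradient with $c$ gives $-(s + \lambda d)$.\<close>

lemma stationarity: "(\<Sum>\<tau>\<in>{1..s}. x \<tau> $ i / (x \<tau> \<bullet> c)) + lam / c $ i = N"
proof -
  have "axis i 1 - c \<in> hull_directions"
    using c_hull axis_in_simplex[of i] by (simp add: diff_in_hull_directions std_simplex_iff)
  then have foc: "loss_grad c (axis i 1 - c) = 0" by (rule loss_grad_minimiser)
  have A: "(\<Sum>\<tau>\<in>{1..s}. (x \<tau> \<bullet> (axis i 1 - c)) / (x \<tau> \<bullet> c)) = (\<Sum>\<tau>\<in>{1..s}. x \<tau> $ i / (x \<tau> \<bullet> c) - 1)"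
    using inner_pos[OF _ c_pos_all] by (intro sum.cong) (force simp: inner_diff_right inner_axis diff_divide_distrib)+
  have B: "(\<Sum>j\<in>UNIV. (axis i 1 - c) $ j / c $ j) = (\<Sum>j\<in>UNIV. (if j = i then 1 / c $ i else 0) - 1)"
    using c_pos by (intro sum.cong) (auto simp: axis_def diff_divide_distrib less_imp_neq[symmetric])
  show ?thesis
    using foc unfolding loss_grad_def A B by (simp add: N_def sum_subtractf right_diff_distrib)
qed

lemma N_pos: "0 < N" using lam_pos by (simp add: N_def add_nonneg_pos)

lemma minimiser_component_ge: "1 / N \<le> c $ i"
proof -
  have "0 \<le> (\<Sum>\<tau>\<in>{1..s}. x \<tau> $ i / (x \<tau> \<bullet> c))"
    by (intro sum_nonneg divide_nonneg_nonneg x_nonneg less_imp_le[OF inner_pos[OF _ c_pos_all]])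
  then have "lam / c $ i \<le> N" using stationarity[of i] by linarith
  moreover have "1 / c $ i \<le> lam / c $ i" using lam_ge_1 c_pos[of i] by (simp add: divide_right_mono)
  ultimately have "1 / c $ i \<le> N" by linarith
  then show ?thesis using c_pos[of i] N_pos by (simp add: field_simps)
qed

text \<open>By Cauchy--Schwarz with the weights $x_\tau[i] c[i] / (x_\tau^\top c)$, which sum to 1 over $i$, each
rank-one term is at most $\sum_i \frac{x_\tau[i]}{x_\tau^\top c} \frac{v[i]^2}{c[i]}$. Adding the
barrier term, the coefficient of $v[i]^2/c[i]$ is exactly the left-hand side of the stationarity
condition, so the whole form is at most $N \sum_i v[i]^2/c[i]$, and $1/c[i] \le N$.\<close>

lemma loss_curv_minimiser_le: "loss_curv c v \<le> N\<^sup>2 * (v \<bullet> v)"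
proof -
  let ?p = "\<lambda>\<tau> i. x \<tau> $ i / (x \<tau> \<bullet> c)"
  have "((x \<tau> \<bullet> v) / (x \<tau> \<bullet> c))\<^sup>2 \<le> (\<Sum>i\<in>UNIV. ?p \<tau> i * ((v $ i)\<^sup>2 / c $ i))" if \<tau>: "\<tau> \<in> {1..s}" for \<tau>
  proof -
    have xc: "0 < x \<tau> \<bullet> c" by (rule inner_pos[OF \<tau> c_pos_all])
    \<comment> \<open>split each summand so that Cauchy--Schwarz produces $x_\tau^\top c$\<close>
    have "(x \<tau> \<bullet> v)\<^sup>2 = (\<Sum>i\<in>UNIV. sqrt (x \<tau> $ i * c $ i) * (sqrt (x \<tau> $ i / c $ i) * v $ i))\<^sup>2"
      unfolding inner_vec_def using c_pos x_nonneg[OF \<tau>]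
      by (intro arg_cong[where f="\<lambda>a. a\<^sup>2"] sum.cong) (auto simp: real_sqrt_mult real_sqrt_divide less_imp_neq[symmetric])
    also have "\<dots> \<le> (\<Sum>i\<in>UNIV. (sqrt (x \<tau> $ i * c $ i))\<^sup>2) * (\<Sum>i\<in>UNIV. (sqrt (x \<tau> $ i / c $ i) * v $ i)\<^sup>2)"
      by (rule Cauchy_Schwarz_ineq_sum)
    also have "\<dots> = (x \<tau> \<bullet> c) * (\<Sum>i\<in>UNIV. x \<tau> $ i / c $ i * (v $ i)\<^sup>2)"
      using c_pos x_nonneg[OF \<tau>] by (simp add: inner_vec_def power_mult_distrib less_imp_le)
    finally have "(x \<tau> \<bullet> v)\<^sup>2 / (x \<tau> \<bullet> c)\<^sup>2 \<le> (x \<tau> \<bullet> c) * (\<Sum>i\<in>UNIV. x \<tau> $ i / c $ i * (v $ i)\<^sup>2) / (x \<tau> \<bullet> c)\<^sup>2"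
      by (rule divide_right_mono) simp
    also have "\<dots> = (\<Sum>i\<in>UNIV. ?p \<tau> i * ((v $ i)\<^sup>2 / c $ i))"
      using xc by (simp add: power2_eq_square sum_divide_distrib mult_ac)
    finally show ?thesis by (simp add: power_divide)
  qed
  then have "loss_curv c v \<le> (\<Sum>\<tau>\<in>{1..s}. \<Sum>i\<in>UNIV. ?p \<tau> i * ((v $ i)\<^sup>2 / c $ i)) + lam * (\<Sum>i\<in>UNIV. (v $ i / c $ i)\<^sup>2)"
    unfolding loss_curv_def by (intro add_mono sum_mono) auto
  also have "\<dots> = (\<Sum>i\<in>UNIV. ((\<Sum>\<tau>\<in>{1..s}. ?p \<tau> i) + lam / c $ i) * ((v $ i)\<^sup>2 / c $ i))"
    unfolding sum_distrib_left distrib_right sum_distrib_right sum.distrib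
    by (subst sum.swap) (simp add: power2_eq_square)
  also have "\<dots> = (\<Sum>i\<in>UNIV. N * ((v $ i)\<^sup>2 / c $ i))" unfolding stationarity ..
  also have "\<dots> \<le> (\<Sum>i\<in>UNIV. N * ((v $ i)\<^sup>2 * N))"
  proof (intro sum_mono mult_left_mono)
    fix i
    have "1 / c $ i \<le> N" using minimiser_component_ge[of i] c_pos[of i] N_pos by (simp add: field_simps)
    then have "(v $ i)\<^sup>2 * (1 / c $ i) \<le> (v $ i)\<^sup>2 * N" by (rule mult_left_mono) simp
    then show "(v $ i)\<^sup>2 / c $ i \<le> (v $ i)\<^sup>2 * N" by simp
  qed (use N_pos in simp)
  also have "\<dots> = N\<^sup>2 * (v \<bullet> v)"
    by (simp add: inner_vec_def sum_distrib_left power2_eq_square mult_ac)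
  finally show ?thesis .
qed

end

section \<open>The uniform density on a small box around the minimiser\<close>

locale entropic_loss = log_loss_minimiser x lam s c for x :: "nat \<Rightarrow> real ^ 'n" and lam s c +
  fixes \<mu> :: real
  assumes \<mu>_pos: "0 < \<mu>" and card_ge_2: "2 \<le> CARD('n)"
begin

text \<open>The Hessian at the minimiser is at most $N^2$, and a vector of the hyperplane whose $d - 1$ coordinates
are below $r$ in absolute value has squared norm below $d r^2$. The half-side solves $N^2 d r^2 = (1/4)^2$.\<close>

definition box_radius :: real where
  "box_radius = 1 / (4 * N * sqrt (real CARD('n)))"

lemma box_radius_pos: "0 < box_radius"
  using N_pos by (simp add: box_radius_def)

definition small_box :: "(real ^ 'n) set" where
  "small_box = hull_box c box_radius"

lemma small_box_curv:
  assumes "w \<in> small_box" "w \<in> simplex_hull"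
  shows "loss_curv c (w - c) < (1 / 4)\<^sup>2"
proof -
  let ?d = "real CARD('n)"
  have "(w - c) \<bullet> (w - c) = (\<Sum>b\<in>hull_basis. ((w - c) \<bullet> b)\<^sup>2)"
    by (rule hull_directions_expansion[OF diff_in_hull_directions[OF assms(2) c_hull]])
  also have "\<dots> \<le> (\<Sum>b\<in>(hull_basis :: (real ^ 'n) set). box_radius\<^sup>2)"
  proof (rule sum_mono)
    fix b :: "real ^ 'n" assume "b \<in> hull_basis"
    then have "\<bar>(w - c) \<bullet> b\<bar> < box_radius" using assms(1) by (simp add: small_box_def hull_box_def)
    then have "\<bar>(w - c) \<bullet> b\<bar>\<^sup>2 \<le> box_radius\<^sup>2" by (intro power_mono) simp_all
    then show "((w - c) \<bullet> b)\<^sup>2 \<le> box_radius\<^sup>2" by simp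
  qed
  also have "\<dots> = (?d - 1) * box_radius\<^sup>2" using card_ge_2 by (simp add: card_hull_basis of_nat_diff)
  also have "\<dots> < ?d * box_radius\<^sup>2" using box_radius_pos by (intro mult_strict_right_mono zero_less_power) simp_all
  also have "\<dots> = (1 / 4)\<^sup>2 / N\<^sup>2" by (simp add: box_radius_def power_divide power_mult_distrib)
  finally have "N\<^sup>2 * ((w - c) \<bullet> (w - c)) < N\<^sup>2 * ((1 / 4)\<^sup>2 / N\<^sup>2)"
    using N_pos by (intro mult_strict_left_mono) simp_all
  then show ?thesis using loss_curv_minimiser_le[of "w - c"] N_pos by simp
qed

definition box_vol :: real where
  "box_vol = (2 * box_radius) ^ (CARD('n) - 1)"

lemma box_vol_pos: "0 < box_vol" unfolding box_vol_def using box_radius_pos by (intro zero_less_power) simp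

lemma emeasure_small_box: "emeasure hull_lborel small_box = ennreal box_vol"
  unfolding small_box_def box_vol_def by (rule emeasure_hull_box) (rule box_radius_pos)

definition box_density :: "real ^ 'n \<Rightarrow> real" where "box_density w = indicator small_box w / box_vol"

lemma small_box_borel [measurable]: "small_box \<in> sets borel"
  unfolding small_box_def by measurable

lemma box_density_Supp: "box_density \<in> Supp (dikin lam x s (1 / 4) c)"
  unfolding Supp_def
proof (intro CollectI conjI allI)
  show "box_density \<in> borel_measurable borel" unfolding box_density_def[abs_def] by measurable
  show "0 \<le> box_density w" for w using box_vol_pos by (simp add: box_density_def)
  have "(\<integral>\<^sup>+w. ennreal (box_density w) \<partial>hull_lborel) = (\<integral>\<^sup>+w. ennreal (1 / box_vol) * indicator small_box w \<partial>hull_lborel)"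
    by (intro nn_integral_cong) (auto simp: box_density_def indicator_def)
  also have "\<dots> = ennreal (1 / box_vol) * ennreal box_vol"
    by (subst nn_integral_cmult_indicator) (simp_all add: emeasure_small_box)
  also have "\<dots> = 1" using box_vol_pos by (simp flip: ennreal_mult)
  finally show "(\<integral>\<^sup>+w. ennreal (box_density w) \<partial>hull_lborel) = 1" .
  show "AE w in hull_lborel. w \<notin> dikin lam x s (1 / 4) c \<longrightarrow> box_density w = 0"
    using AE_hull_lborel_in_hull
    by eventually_elim (auto simp: box_density_def indicator_def dikin_iff[OF c_pos_all] dest: small_box_curv)
qed

lemma mean_box_density: "mean box_density = c"
proof -
  note sub = dikin_subset_simplex[OF c_pos_all]
  have id: "integrable (law box_density) (\<lambda>w. w)"
    by (rule integrable_law_continuous[OF box_density_Supp sub]) (intro continuous_intros)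
  have "(\<integral>w. w - c \<partial>law box_density) = (\<integral>w. box_density w *\<^sub>R (w - c) \<partial>hull_lborel)"
    by (rule integral_law[OF box_density_Supp]) measurable
  also have "\<dots> = (1 / box_vol) *\<^sub>R (\<integral>w. indicator small_box w *\<^sub>R (w - c) \<partial>hull_lborel)"
    by (simp add: box_density_def flip: integral_scaleR_right)
  also have "\<dots> = 0"
    unfolding small_box_def integral_hull_box_centred[OF box_radius_pos c_hull] by simp
  finally have "(\<integral>w. w - c \<partial>law box_density) = 0" .
  moreover have "(\<integral>w. w - c \<partial>law box_density) = mean box_density - c"
    using id emeasure_law_UNIV[OF box_density_Supp] finite_measure.integrable_const[OF finite_measure_law[OF box_density_Supp]]
    by (subst Bochner_Integration.integral_diff) (auto simp: mean_def measure_def)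
  ultimately show ?thesis by simp
qed

lemma box_density_feasible: "box_density \<in> feasible lam x s"
  using box_density_Supp c_pos c_hull by (auto simp: feasible_def mean_box_density rel_interior_std_simplex_iff)

lemma Ent_box_density: "Ent box_density = ereal (ln box_vol)"
proof -
  have "AE w in law box_density. ereal (- ln (box_density w)) = ereal (ln box_vol)"
    using AE_law[OF box_density_Supp]
    by eventually_elim (use box_vol_pos in \<open>auto simp: box_density_def indicator_def ln_div split: if_splits\<close>)
  then have "Ent box_density = ereal (\<integral>w. ln box_vol \<partial>law box_density)"
    unfolding Ent_def
    by (intro ext_expectation_eq_integral finite_measure.integrable_const finite_measure_law[OF box_density_Supp])
  then show ?thesis by (simp only: integral_law_const[OF box_density_Supp])
qed

text \<open>The density lives on the Dikin ellipsoid of radius $1/4$, so the trace term is at most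
$\frac45 \cdot \frac1{16} = \frac1{20}$, and the entropy is the logarithm of the volume of the box.\<close>

lemma Fbar_box_density_le: "Fbar \<mu> lam x s box_density \<le> ereal (loss_fin lam x s c + 1 / 20 - \<mu> * ln box_vol)"
proof -
  note sub = dikin_subset_simplex[OF c_pos_all]
  have "trace (hessian (loss_fin lam x s) c ** Cov box_density) = (\<integral>w. loss_curv c (w - c) \<partial>law box_density)"
    using trace_hessian_Cov[OF _ box_density_Supp sub] c_pos by (simp add: mean_box_density)
  also have "\<dots> \<le> (\<integral>w. 1 / 16 \<partial>law box_density)"
  proof (rule integral_mono_AE)
    show "integrable (law box_density) (\<lambda>w. loss_curv c (w - c))"
      by (rule integrable_law_continuous[OF box_density_Supp sub continuous_on_loss_curv])
    show "integrable (law box_density) (\<lambda>w. 1 / 16 :: real)"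
      by (intro finite_measure.integrable_const finite_measure_law[OF box_density_Supp])
    show "AE w in law box_density. loss_curv c (w - c) \<le> 1 / 16"
      using AE_law[OF box_density_Supp]
      by eventually_elim (auto simp: dikin_iff[OF c_pos_all] power2_eq_square)
  qed
  also have "\<dots> = 1 / 16" by (rule integral_law_const[OF box_density_Supp])
  finally have "4 / 5 * trace (hessian (loss_fin lam x s) c ** Cov box_density) \<le> 1 / 20" by simp
  then show ?thesis
    unfolding Fbar_def mean_box_density Ent_box_density using c_pos by (simp add: loss_def)
qed

section \<open>The Gibbs density\<close>

definition open_simplex :: "(real ^ 'n) set" where
  "open_simplex = {w \<in> std_simplex. \<forall>i. 0 < w $ i}"

lemma open_simplex_borel [measurable]: "open_simplex \<in> sets borel"
proof -
  have "open_simplex = std_simplex \<inter> {w. \<forall>i. 0 < w $ i}" by (auto simp: open_simplex_def)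
  then show ?thesis using borel_closed[OF compact_imp_closed[OF compact_std_simplex]] pos_borel by (metis sets.Int)
qed

lemma open_simplex_subset_box: "open_simplex \<subseteq> hull_box c 2"
  using std_simplex_subset_hull_box[OF c_simplex] by (auto simp: open_simplex_def)

lemma emeasure_box_2: "emeasure hull_lborel (hull_box c 2) = ennreal (4 ^ (CARD('n) - 1))"
  using emeasure_hull_box[of 2 c] by simp

lemma emeasure_open_simplex: "emeasure hull_lborel open_simplex < \<infinity>"
proof -
  have "emeasure hull_lborel open_simplex \<le> emeasure hull_lborel (hull_box c 2)"
    by (rule emeasure_mono[OF open_simplex_subset_box]) simp
  then show ?thesis unfolding emeasure_box_2 by (simp add: le_less_trans)
qed

lemma loss_ge_on_open_simplex: "w \<in> open_simplex \<Longrightarrow> loss_fin lam x s c \<le> loss_fin lam x s w"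
  using c_min[of w] by (auto simp: open_simplex_def std_simplex_iff)

definition weight :: "real ^ 'n \<Rightarrow> real" where
  "weight w = indicator open_simplex w * exp (- loss_fin lam x s w / \<mu>)"

lemma weight_measurable [measurable]: "weight \<in> borel_measurable borel"
  unfolding weight_def[abs_def] by measurable

lemma weight_nonneg: "0 \<le> weight w" by (simp add: weight_def)

lemma weight_pos_iff: "0 < weight w \<longleftrightarrow> w \<in> open_simplex"
  by (simp add: weight_def indicator_def)

lemma weight_le: "weight w \<le> exp (- loss_fin lam x s c / \<mu>) * indicator (hull_box c 2) w"
  using open_simplex_subset_box loss_ge_on_open_simplex[of w] \<mu>_pos
  by (auto simp: weight_def indicator_def divide_right_mono)

text \<open>Integrability of $e^{-L/\mu} L$ makes the expected loss of the Gibbs density finite. Although $L$ is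
unbounded near the boundary, the product is bounded, because $y e^{-y/\mu} \le \mu$ for the excess
$y \ge 0$ of $L$ over its minimum.\<close>

lemma integrable_weight: "integrable hull_lborel weight"
  and integrable_weight_loss: "integrable hull_lborel (\<lambda>w. weight w * loss_fin lam x s w)"
proof -
  let ?l = "loss_fin lam x s c"
  let ?B = "exp (- ?l / \<mu>)"
  show "integrable hull_lborel weight"
  proof (rule integrableI_bounded_set[where A = open_simplex and B = ?B])
    show "AE w in hull_lborel. w \<in> open_simplex \<longrightarrow> norm (weight w) \<le> ?B"
      using loss_ge_on_open_simplex \<mu>_pos by (auto simp: weight_def divide_right_mono)
  qed (use emeasure_open_simplex in \<open>auto simp: weight_def\<close>)
  show "integrable hull_lborel (\<lambda>w. weight w * loss_fin lam x s w)"
  proof (rule integrableI_bounded_set[where A = open_simplex and B = "?B * \<mu> + ?B * \<bar>?l\<bar>"])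
    have "norm (weight w * loss_fin lam x s w) \<le> ?B * \<mu> + ?B * \<bar>?l\<bar>" if w: "w \<in> open_simplex" for w
    proof -
      define y where "y = loss_fin lam x s w - ?l"
      have y: "0 \<le> y" using loss_ge_on_open_simplex[OF w] by (simp add: y_def)
      have "1 + y / \<mu> \<le> exp (y / \<mu>)" by (rule exp_ge_add_one_self)
      then have "y / \<mu> \<le> exp (y / \<mu>)" by linarith
      then have "y \<le> \<mu> * exp (y / \<mu>)" using \<mu>_pos by (simp add: field_simps)
      then have 1: "exp (- y / \<mu>) * y \<le> \<mu>"
        using mult_left_mono[of y "\<mu> * exp (y / \<mu>)" "exp (- y / \<mu>)"] by (simp add: mult.left_commute flip: exp_add)
      have 2: "exp (- y / \<mu>) * \<bar>?l\<bar> \<le> \<bar>?l\<bar>"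
        using y \<mu>_pos by (intro mult_left_le_one_le) auto
      have "weight w = ?B * exp (- y / \<mu>)"
        using w by (simp add: weight_def y_def diff_divide_distrib flip: exp_add)
      then have "norm (weight w * loss_fin lam x s w) = ?B * (exp (- y / \<mu>) * \<bar>y + ?l\<bar>)"
        by (simp add: abs_mult y_def)
      also have "\<dots> \<le> ?B * (exp (- y / \<mu>) * (y + \<bar>?l\<bar>))"
        using y by (intro mult_left_mono) auto
      also have "\<dots> \<le> ?B * (\<mu> + \<bar>?l\<bar>)"
        using 1 2 by (intro mult_left_mono) (auto simp: distrib_left)
      finally show ?thesis by (simp add: distrib_left)
    qed
    then show "AE w in hull_lborel. w \<in> open_simplex \<longrightarrow> norm (weight w * loss_fin lam x s w) \<le> ?B * \<mu> + ?B * \<bar>?l\<bar>"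
      by simp
  qed (use emeasure_open_simplex in \<open>auto simp: weight_def\<close>)
qed

definition Z :: real where "Z = (\<integral>w. weight w \<partial>hull_lborel)"

text \<open>Almost every point of the small box lies in the open simplex, where the weight is positive, and the box
has positive volume.\<close>

lemma Z_pos: "0 < Z"
proof -
  have "Z \<noteq> 0"
  proof
    assume "Z = 0"
    then have "AE w in hull_lborel. weight w = 0"
      unfolding Z_def using integral_nonneg_eq_0_iff_AE[OF integrable_weight] weight_nonneg by simp
    with AE_hull_lborel_in_hull have "AE w in hull_lborel. w \<notin> small_box"
    proof eventually_elim
      case (elim w)
      then have "w \<notin> open_simplex" using weight_pos_iff[of w] by simp
      then show ?case
        using elim(1) dikin_subset_pos[OF c_pos_all small_box_curv]
        by (auto simp: open_simplex_def std_simplex_iff less_imp_le)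
    qed
    then have "emeasure hull_lborel small_box = 0"
      by (subst (asm) AE_iff_measurable[where N = small_box]) auto
    then show False using box_vol_pos by (simp add: emeasure_small_box)
  qed
  moreover have "0 \<le> Z" unfolding Z_def by (simp add: weight_nonneg)
  ultimately show ?thesis by simp
qed

lemma Z_le: "Z \<le> exp (- loss_fin lam x s c / \<mu>) * 4 ^ (CARD('n) - 1)"
proof -
  have "integrable hull_lborel (indicator (hull_box c 2) :: _ \<Rightarrow> real)"
    by (rule integrable_real_indicator) (simp_all add: emeasure_box_2)
  then have "Z \<le> (\<integral>w. exp (- loss_fin lam x s c / \<mu>) * indicator (hull_box c 2) w \<partial>hull_lborel)"
    unfolding Z_def using integrable_weight weight_le by (intro integral_mono) auto
  also have "\<dots> = exp (- loss_fin lam x s c / \<mu>) * 4 ^ (CARD('n) - 1)"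
    by (simp add: measure_def emeasure_box_2)
  finally show ?thesis .
qed

definition gibbs_density :: "real ^ 'n \<Rightarrow> real" where "gibbs_density w = weight w / Z"

lemma gibbs_density_Supp: "gibbs_density \<in> Supp open_simplex"
  unfolding Supp_def
proof (intro CollectI conjI allI)
  show "gibbs_density \<in> borel_measurable borel" unfolding gibbs_density_def[abs_def] by measurable
  show "0 \<le> gibbs_density w" for w using Z_pos weight_nonneg by (simp add: gibbs_density_def)
  have "(\<integral>\<^sup>+w. ennreal (gibbs_density w) \<partial>hull_lborel) = ennreal (\<integral>w. gibbs_density w \<partial>hull_lborel)"
    unfolding gibbs_density_def[abs_def] using integrable_weight Z_pos weight_nonneg
    by (intro nn_integral_eq_integral) auto
  also have "(\<integral>w. gibbs_density w \<partial>hull_lborel) = 1"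
    using Z_pos by (simp add: gibbs_density_def flip: Z_def)
  finally show "(\<integral>\<^sup>+w. ennreal (gibbs_density w) \<partial>hull_lborel) = 1" by simp
  show "AE w in hull_lborel. w \<notin> open_simplex \<longrightarrow> gibbs_density w = 0"
    by (simp add: gibbs_density_def weight_def)
qed

lemma ln_gibbs_density:
  assumes "w \<in> open_simplex"
  shows "ln (gibbs_density w) = - loss_fin lam x s w / \<mu> - ln Z"
  using assms Z_pos by (simp add: gibbs_density_def ln_div weight_pos_iff) (simp add: weight_def)

lemma F_gibbs_density: "F \<mu> lam x s gibbs_density = ereal (- \<mu> * ln Z)"
proof -
  let ?L = "loss_fin lam x s" and ?M = "law gibbs_density"
  have IL: "integrable ?M ?L"
    unfolding integral_law(2)[OF gibbs_density_Supp loss_fin_measurable]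
    using integrable_weight_loss by (simp add: gibbs_density_def)
  have AE: "AE w in ?M. w \<in> open_simplex" using AE_law[OF gibbs_density_Supp] by (auto elim: eventually_mono)
  have "ext_expectation ?M (loss lam x s) = ereal (\<integral>w. ?L w \<partial>?M)"
    using AE by (intro ext_expectation_eq_integral IL) (auto elim!: eventually_mono simp: loss_def open_simplex_def)
  moreover have "Ent gibbs_density = ereal (\<integral>w. ?L w / \<mu> + ln Z \<partial>?M)"
    unfolding Ent_def using AE IL finite_measure.integrable_const[OF finite_measure_law[OF gibbs_density_Supp]]
    by (intro ext_expectation_eq_integral Bochner_Integration.integrable_add)
      (auto elim!: eventually_mono simp: ln_gibbs_density)
  moreover have "(\<integral>w. ?L w / \<mu> + ln Z \<partial>?M) = (\<integral>w. ?L w \<partial>?M) / \<mu> + ln Z"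
    using IL finite_measure.integrable_const[OF finite_measure_law[OF gibbs_density_Supp]]
      integral_law_const[OF gibbs_density_Supp, of "ln Z"]
    by (subst Bochner_Integration.integral_add) auto
  ultimately show ?thesis
    unfolding F_def using \<mu>_pos by (simp add: distrib_left)
qed

text \<open>For a density supported on the simplex, neither the expected loss nor the negated entropy can be
$-\infty$: the loss is bounded below by its minimum, and $-y \log y \le 1$ is integrated over a set of
finite volume.\<close>

lemma neg_loss_part_finite:
  assumes \<phi>: "\<phi> \<in> Supp std_simplex"
  shows "(\<integral>\<^sup>+w. e2ennreal (- loss lam x s w) \<partial>law \<phi>) \<noteq> \<infinity>"
proof -
  have "(\<integral>\<^sup>+w. e2ennreal (- loss lam x s w) \<partial>law \<phi>) \<le> (\<integral>\<^sup>+w. ennreal \<bar>loss_fin lam x s c\<bar> \<partial>law \<phi>)"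
  proof (rule nn_integral_mono_AE, use AE_law[OF \<phi>] in eventually_elim)
    case (elim w)
    then show ?case
      using c_min[of w] by (auto simp: loss_def e2ennreal_ereal e2ennreal_neg intro!: ennreal_leI)
  qed
  also have "\<dots> < \<infinity>" using emeasure_law_UNIV[OF \<phi>] by simp
  finally show ?thesis by simp
qed

lemma pos_entropy_part_finite:
  fixes \<phi> :: "real ^ 'n \<Rightarrow> real"
  assumes \<phi>: "\<phi> \<in> Supp std_simplex"
  shows "(\<integral>\<^sup>+w. e2ennreal (ereal (- ln (\<phi> w))) \<partial>law \<phi>) \<noteq> \<infinity>"
proof -
  note [measurable] = Supp_measurable[OF \<phi>]
  have *: "ennreal (\<phi> w) * e2ennreal (ereal (- ln (\<phi> w))) \<le> 1" for w
  proof (cases "0 < \<phi> w")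
    case True
    then have "\<phi> w * - ln (\<phi> w) \<le> 1"
      using ln_add_one_self_le_self2[of "1 / \<phi> w - 1"] by (simp add: ln_div field_simps)
    then have "ennreal (\<phi> w * - ln (\<phi> w)) \<le> 1" using ennreal_leI by fastforce
    then show ?thesis using True by (simp only: e2ennreal_ereal ennreal_mult'[OF less_imp_le])
  qed (use Supp_nonneg[OF \<phi>, of w] in simp)
  have "(\<integral>\<^sup>+w. e2ennreal (ereal (- ln (\<phi> w))) \<partial>law \<phi>)
      = (\<integral>\<^sup>+w. ennreal (\<phi> w) * e2ennreal (ereal (- ln (\<phi> w))) \<partial>hull_lborel)"
    unfolding law_def by (rule nn_integral_density) measurable
  also have "\<dots> \<le> (\<integral>\<^sup>+w. indicator (hull_box c 2) w \<partial>hull_lborel)"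
  proof (rule nn_integral_mono_AE)
    have "AE w in hull_lborel. w \<notin> std_simplex \<longrightarrow> \<phi> w = 0" using \<phi> by (simp add: Supp_def)
    then show "AE w in hull_lborel. ennreal (\<phi> w) * e2ennreal (ereal (- ln (\<phi> w))) \<le> indicator (hull_box c 2) w"
      by eventually_elim
        (use * std_simplex_subset_hull_box[OF c_simplex] in \<open>auto simp: indicator_def\<close>)
  qed
  also have "\<dots> < \<infinity>" by (simp add: emeasure_box_2)
  finally show ?thesis by simp
qed

text \<open>If the expected loss or the negated entropy is infinite, so is the objective. Otherwise, with $g$ the
Gibbs density, the claim is $\mathbb{E}_\phi[\log(\phi/g)] \ge 0$, which follows from
$\log(\phi/g) \ge 1 - g/\phi$ and $\mathbb{E}_\phi[g/\phi] \le \int g = 1$.\<close>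

lemma gibbs_variational:
  assumes \<phi>: "\<phi> \<in> Supp std_simplex"
  shows "ereal (- \<mu> * ln Z) \<le> F \<mu> lam x s \<phi>"
proof -
  note [measurable] = Supp_measurable[OF \<phi>]
  let ?M = "law \<phi>" and ?L = "loss_fin lam x s"
  let ?lp = "\<integral>\<^sup>+w. e2ennreal (loss lam x s w) \<partial>?M" and ?ln = "\<integral>\<^sup>+w. e2ennreal (- loss lam x s w) \<partial>?M"
  let ?ep = "\<integral>\<^sup>+w. e2ennreal (ereal (- ln (\<phi> w))) \<partial>?M"
  let ?en = "\<integral>\<^sup>+w. e2ennreal (- ereal (- ln (\<phi> w))) \<partial>?M"
  have ln: "?ln \<noteq> \<infinity>" and ep: "?ep \<noteq> \<infinity>"
    using neg_loss_part_finite[OF \<phi>] pos_entropy_part_finite[OF \<phi>] by auto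
  consider "?lp = \<infinity>" | "?en = \<infinity>" | (fin) "?lp \<noteq> \<infinity>" "?en \<noteq> \<infinity>" by blast
  then show ?thesis
  proof cases
    case 1
    then have "ext_expectation ?M (loss lam x s) = \<infinity>"
      using ln unfolding ext_expectation_def by (cases ?ln) auto
    moreover have "Ent \<phi> \<noteq> \<infinity>"
      using ep unfolding Ent_def ext_expectation_def by (cases ?ep; cases ?en) auto
    ultimately show ?thesis unfolding F_def using \<mu>_pos by (cases "Ent \<phi>") auto
  next
    case 2
    then have "Ent \<phi> = - \<infinity>"
      using ep unfolding Ent_def ext_expectation_def by (cases ?ep) auto
    then show ?thesis unfolding F_def using \<mu>_pos by (cases "ext_expectation ?M (loss lam x s)") auto
  next
    case fin
    have Lm: "loss lam x s \<in> borel_measurable ?M" and em: "(\<lambda>w. ereal (- ln (\<phi> w))) \<in> borel_measurable ?M"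
      by measurable
    note lossI = integrable_of_ext_expectation_parts[OF Lm fin(1) ln]
    note entI = integrable_of_ext_expectation_parts(1)[OF em ep fin(2)]
    \<comment> \<open>a finite expected loss keeps the law off the boundary, where the loss is infinite\<close>
    have AEloss: "AE w in ?M. w \<in> open_simplex \<and> 0 < \<phi> w \<and> loss lam x s w = ereal (?L w)"
      using lossI(2) AE_law[OF \<phi>]
      by eventually_elim (auto simp: loss_def open_simplex_def split: if_splits)
    have IL: "integrable ?M ?L"
      using lossI(1)
    proof (rule integrable_cong_AE_imp)
      show "AE w in ?M. real_of_ereal (loss lam x s w) = ?L w"
        using AEloss by eventually_elim simp
    qed measurable
    have Ie: "integrable ?M (\<lambda>w. ln (\<phi> w))" using entI by simp
    have Ic: "integrable ?M (\<lambda>w. a)" for a :: real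
      by (intro finite_measure.integrable_const finite_measure_law[OF \<phi>])
    let ?r = "\<lambda>w. gibbs_density w / \<phi> w"
    have r: "\<phi> w * ?r w = gibbs_density w * indicator {w. 0 < \<phi> w} w" for w
      using Supp_nonneg[OF \<phi>, of w] by (auto simp: indicator_def less_le)
    have Ig: "integrable hull_lborel gibbs_density" and Zg: "(\<integral>w. gibbs_density w \<partial>hull_lborel) = 1"
      using integrable_weight Z_pos by (simp_all add: gibbs_density_def[abs_def] flip: Z_def)
    have g0: "0 \<le> gibbs_density w" for w using gibbs_density_Supp by (rule Supp_nonneg)
    have rm [measurable]: "?r \<in> borel_measurable borel"
      using Supp_measurable[OF gibbs_density_Supp] by measurable
    have Igi: "integrable hull_lborel (\<lambda>w. gibbs_density w * indicator {w. 0 < \<phi> w} w)"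
      by (rule integrable_real_mult_indicator[OF _ Ig]) measurable
    have Ir: "integrable ?M ?r"
      unfolding integral_law(2)[OF \<phi> rm] using Igi by (simp only: real_scaleR_def r)
    have "(\<integral>w. ?r w \<partial>?M) = (\<integral>w. gibbs_density w * indicator {w. 0 < \<phi> w} w \<partial>hull_lborel)"
      unfolding integral_law(1)[OF \<phi> rm] by (simp only: real_scaleR_def r)
    also have "\<dots> \<le> (\<integral>w. gibbs_density w \<partial>hull_lborel)"
      using g0 by (intro integral_mono Igi Ig) (auto simp: indicator_def)
    finally have r1: "(\<integral>w. ?r w \<partial>?M) \<le> 1" using Zg by simp
    have "0 \<le> (\<integral>w. 1 - ?r w \<partial>?M)"
      using r1 Ic Ir integral_law_const[OF \<phi>, of 1] by (subst Bochner_Integration.integral_diff) auto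
    also have "\<dots> \<le> (\<integral>w. ?L w / \<mu> + ln (\<phi> w) + ln Z \<partial>?M)"
    proof (rule integral_mono_AE)
      show "AE w in ?M. 1 - ?r w \<le> ?L w / \<mu> + ln (\<phi> w) + ln Z"
        using AEloss
      proof eventually_elim
        case (elim w)
        then have g: "0 < gibbs_density w" using Z_pos by (simp add: gibbs_density_def weight_pos_iff)
        then have "ln (?r w) \<le> ?r w - 1" using elim by (intro ln_le_minus_one) simp
        then show ?case using elim g ln_gibbs_density[of w] by (simp add: ln_div)
      qed
    qed (use Ic Ir IL Ie in auto)
    also have "\<dots> = (\<integral>w. ?L w \<partial>?M) / \<mu> + (\<integral>w. ln (\<phi> w) \<partial>?M) + ln Z"
      using IL Ie Ic integral_law_const[OF \<phi>, of "ln Z"] by simp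
    finally have "0 \<le> \<mu> * ((\<integral>w. ?L w \<partial>?M) / \<mu> + (\<integral>w. ln (\<phi> w) \<partial>?M) + ln Z)"
      using \<mu>_pos by simp
    then have main: "- \<mu> * ln Z \<le> (\<integral>w. ?L w \<partial>?M) - \<mu> * (\<integral>w. - ln (\<phi> w) \<partial>?M)"
      using \<mu>_pos by (simp add: distrib_left)
    have "ext_expectation ?M (loss lam x s) = ereal (\<integral>w. ?L w \<partial>?M)"
      using AEloss by (intro ext_expectation_eq_integral IL) (auto simp: eventually_conj_iff)
    moreover have "Ent \<phi> = ereal (\<integral>w. - ln (\<phi> w) \<partial>?M)"
      unfolding Ent_def using Ie by (intro ext_expectation_eq_integral) auto
    ultimately show ?thesis unfolding F_def using main by simp
  qed
qed

lemma gibbs_density_is_arg_min: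
  "is_arg_min (F \<mu> lam x s) (\<lambda>\<phi>. \<phi> \<in> Supp std_simplex) gibbs_density"
proof -
  have "gibbs_density \<in> Supp std_simplex"
    using gibbs_density_Supp Supp_mono[of open_simplex std_simplex] by (auto simp: open_simplex_def)
  then show ?thesis
    unfolding is_arg_min_def using gibbs_variational by (auto simp: F_gibbs_density not_less)
qed

section \<open>Comparison of the two values\<close>

text \<open>The minimal loss cancels, leaving $\mu$ times the logarithm of the ratio of the volumes
$4^{d-1}$ and $(2r)^{d-1}$, where $2/r = 8 N \sqrt d$.\<close>

lemma Fbar_box_density_le_F_gibbs_density:
  "Fbar \<mu> lam x s box_density \<le> F \<mu> lam x s gibbs_density
     + ereal (\<mu> * (real CARD('n) - 1) * ln (8 * N * sqrt (real CARD('n))) + 1 / 20)"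
proof -
  let ?d = "real CARD('n)"
  have d: "real (CARD('n) - 1) = ?d - 1" using card_ge_2 by simp
  have "ln Z \<le> ln (exp (- loss_fin lam x s c / \<mu>) * 4 ^ (CARD('n) - 1))"
    using Z_le Z_pos by simp
  also have "\<dots> = - loss_fin lam x s c / \<mu> + (?d - 1) * ln 4"
    by (simp add: ln_mult_pos ln_realpow d)
  finally have "ln Z \<le> - loss_fin lam x s c / \<mu> + (?d - 1) * ln 4" .
  then have "\<mu> * ln Z \<le> \<mu> * (- loss_fin lam x s c / \<mu> + (?d - 1) * ln 4)"
    using \<mu>_pos by (intro mult_left_mono) simp_all
  also have "\<dots> = - loss_fin lam x s c + \<mu> * ((?d - 1) * ln 4)"
    using \<mu>_pos by (simp add: right_diff_distrib)
  finally have Z: "\<mu> * ln Z \<le> - loss_fin lam x s c + \<mu> * ((?d - 1) * ln 4)" .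
  have A: "ln box_vol = - (?d - 1) * ln (2 * N * sqrt ?d)"
    using N_pos unfolding box_vol_def box_radius_def by (simp add: ln_realpow d ln_div mult_ac left_diff_distrib)
  have B: "ln (8 * N * sqrt ?d) = ln 4 + ln (2 * N * sqrt ?d)"
    using N_pos by (simp flip: ln_mult_pos)
  have "loss_fin lam x s c + 1 / 20 - \<mu> * ln box_vol \<le> - \<mu> * ln Z + (\<mu> * (?d - 1) * ln (8 * N * sqrt ?d) + 1 / 20)"
    unfolding A B using Z by (simp add: algebra_simps)
  then show ?thesis
    unfolding F_gibbs_density using order_trans[OF Fbar_box_density_le] by simp
qed

end

lemma dimension_bound:
  fixes N M d \<mu> :: real
  assumes "0 < N" "N \<le> M" "1 \<le> d" "d \<le> M" "0 < \<mu>"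
  shows "\<mu> * (d - 1) * ln (8 * N * sqrt d) + 1 / 20
    \<le> 1.5 * \<mu> * (d - 1) * ln M + 3.9 * \<mu> * (d + 1) + 0.1"
proof -
  have M: "0 < M" using assms by linarith
  have "exp (3.9 :: real) \<ge> 1 + 3.9 + 3.9\<^sup>2 / 2" by (rule exp_lower_Taylor_quadratic) simp
  then have "(8::real) \<le> exp 3.9" by (simp add: power2_eq_square)
  then have "ln 8 \<le> ln (exp (3.9::real))" by (intro ln_mono) simp_all
  then have "ln 8 \<le> (3.9::real)" by simp
  moreover have "ln (8 * N * sqrt d) = ln 8 + ln N + ln d / 2"
    using assms by (simp add: ln_mult_pos ln_sqrt)
  moreover have "ln N \<le> ln M" "ln d \<le> ln M" using assms by simp_all
  ultimately have "ln (8 * N * sqrt d) \<le> 3.9 + 1.5 * ln M" by simp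
  then have "\<mu> * (d - 1) * ln (8 * N * sqrt d) \<le> \<mu> * (d - 1) * (3.9 + 1.5 * ln M)"
    using assms by (intro mult_left_mono) auto
  also have "\<dots> \<le> 1.5 * \<mu> * (d - 1) * ln M + 3.9 * \<mu> * (d + 1)"
    using assms by (simp add: algebra_simps)
  finally show ?thesis by simp
qed

theorem proposition2p2:
  fixes x :: "nat \<Rightarrow> real ^ 'n"
    and T t :: nat
    and lam \<mu> :: real
    and \<phi>bar :: "real ^ 'n \<Rightarrow> real"
  assumes "CARD('n) \<ge> 2"
    and "T \<ge> 1"
    and "t \<in> {1..T}"
    and "\<And>\<tau>. \<tau> \<in> {1..T} \<Longrightarrow> (\<forall>i. 0 \<le> x \<tau> $ i) \<and> x \<tau> \<noteq> 0"
    and "lam \<ge> 1"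
    and "\<mu> > 0"
    and "is_arg_min (Fbar \<mu> lam x (t - 1)) (\<lambda>\<phi>. \<phi> \<in> feasible lam x (t - 1)) \<phi>bar"
  shows "F \<mu> lam x (t - 1) \<phi>bar \<le> Fbar \<mu> lam x (t - 1) \<phi>bar
    \<and> (\<exists>\<phi>min. is_arg_min (F \<mu> lam x (t - 1)) (\<lambda>\<phi>. \<phi> \<in> Supp std_simplex) \<phi>min
         \<and> Fbar \<mu> lam x (t - 1) \<phi>bar \<le> F \<mu> lam x (t - 1) \<phi>min
             + ereal (1.5 * \<mu> * (real CARD('n) - 1) * ln (real T + lam * real CARD('n))
                      + 3.9 * \<mu> * (real CARD('n) + 1) + 0.1))"
proof -
  interpret log_loss x lam "t - 1"
    using assms(3-5) by unfold_locales auto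
  obtain c where c: "\<forall>i. 0 < c $ i" "c \<in> simplex_hull"
    "\<forall>w\<in>simplex_hull. (\<forall>i. 0 < w $ i) \<longrightarrow> loss_fin lam x (t - 1) c \<le> loss_fin lam x (t - 1) w"
    using ex_loss_minimiser by blast
  interpret entropic_loss x lam "t - 1" c \<mu>
    using c assms(1,6) by unfold_locales auto
  let ?bound = "1.5 * \<mu> * (real CARD('n) - 1) * ln (real T + lam * real CARD('n))
                      + 3.9 * \<mu> * (real CARD('n) + 1) + 0.1"
  have "real (t - 1) \<le> real T" using assms(3) by simp
  moreover have "real CARD('n) \<le> lam * real CARD('n)" using assms(5) by simp
  then have "real CARD('n) \<le> real T + lam * real CARD('n)" by linarith
  ultimately have num: "\<mu> * (real CARD('n) - 1) * ln (8 * N * sqrt (real CARD('n))) + 1 / 20 \<le> ?bound"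
    using assms(1,6) N_pos unfolding N_def by (intro dimension_bound) auto
  have "Fbar \<mu> lam x (t - 1) \<phi>bar \<le> Fbar \<mu> lam x (t - 1) box_density"
    using assms(7) box_density_feasible by (auto simp: is_arg_min_def not_less)
  also have "\<dots> \<le> F \<mu> lam x (t - 1) gibbs_density
     + ereal (\<mu> * (real CARD('n) - 1) * ln (8 * N * sqrt (real CARD('n))) + 1 / 20)"
    by (rule Fbar_box_density_le_F_gibbs_density)
  also have "\<dots> \<le> F \<mu> lam x (t - 1) gibbs_density + ereal ?bound"
    using num by (intro add_left_mono) simp
  finally show ?thesis
    using F_le_Fbar[of \<phi>bar \<mu>] gibbs_density_is_arg_min assms(7) by (auto simp: is_arg_min_def)
qed

end
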